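(* Let $c>0$ be an absolute constant with the following property (P): for every $n\ge1$, every ellipsoid $E$ in $\mathbf{R}^n$, every orthonormal basis of $\mathbf{R}^n$ and every $\theta\in(0,1)$ there exists $\sigma\subseteq\{1,\ldots,n\}$ with $|\sigma|\ge(1-\theta)n$ and $\mathcal{P}_{\sigma}(E)\supseteq\frac{c\sqrt{\theta}}{\log^{1/2}(2/\theta)M_E}D_{\sigma}$. Put $c_1=\max\{\frac{8}{c^2},\frac{1}{\log 2}\}$. Let $\{e_1,\ldots,e_n\}$ be an orthonormal basis of $\mathbf{R}^n$, let $\varepsilon\in(0,1)$ and let $F$ be a subspace of $\mathbf{R}^n$ with $\dim F=m\ge(1-\varepsilon)n$. Then for every non-degenerate ellipsoid $E$ in $F$ and for every $\zeta\in[c_1\varepsilon\log(\frac{2}{\varepsilon}),1)$ there exists $\sigma\subseteq\{1,\ldots,n\}$ with $|\sigma|\ge(1-\zeta)n$ such that $$\mathcal{P}_{\sigma}(E)\supseteq\frac{c\sqrt{\zeta}}{2\sqrt2\,\log^{1/2}\left(\frac{2}{\zeta}\right)M_E}\,D_{\sigma}.$$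
   Context: $\mathbf{R}^n$ carries an inner product $\langle\cdot,\cdot\rangle$ with Euclidean norm $|\cdot|$, unit ball $D_n$ and unit sphere $S^{n-1}$. Ellipsoids are origin-centred and non-degenerate in the space in which they live. For a symmetric convex body $K$ in a subspace $F$ of $\mathbf{R}^n$ (possibly $F=\mathbf{R}^n$), with norm $\|\cdot\|_K$ on $F$ having unit ball $K$, $M_K=\left(\int_{S^{n-1}\cap F}\|x\|_K^2\,d\mu_F(x)\right)^{1/2}$, where $\mu_F$ is the rotationally invariant probability measure on the unit sphere $S^{n-1}\cap F$ of $F$. For $\sigma\subseteq\{1,\ldots,n\}$, $|\sigma|$ is its cardinality, $\mathbf{R}^{\sigma}=\{x\in\mathbf{R}^n:\langle x,e_j\rangle=0\text{ if }j\notin\sigma\}$ (with respect to the given orthonormal basis), $\mathcal{P}_{\sigma}$ is the orthogonal projection onto $\mathbf{R}^{\sigma}$, and $D_{\sigma}=D_n\cap\mathbf{R}^{\sigma}$. An absolute constant $c>0$ with property (P) is known to exist (it is a theorem of the paper), and the constant $c$ in the claim is that constant. *)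

theory Defs
  imports "HOL-Probability.Probability"
begin

text \<open>
  The hypothesis \<open>property_P\<close> quantifies over all dimensions \<open>n\<close>, so the spaces \<open>R\<^sup>n\<close> have to live in one
  type.  We use the inner product space of finitely supported real sequences and take \<open>R\<^sup>n\<close> to be
  its subspace of sequences supported in \<open>{1..n}\<close>, with the induced (standard) inner product.
\<close>

typedef fin_seq = "{f :: nat \<Rightarrow> real. finite {i. f i \<noteq> 0}}"
  morphisms coord Abs_fin_seq
  by (rule exI[of _ "\<lambda>_. 0"]) simp

setup_lifting type_definition_fin_seq

lemma finite_support: "finite {i. coord x i \<noteq> 0}"
  using coord[of x] by simp

lemma fin_seq_eq_iff: "x = y \<longleftrightarrow> (\<forall>i. coord x i = coord y i)"
  by (metis coord_inject ext)

instantiation fin_seq :: real_vector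
begin

lift_definition zero_fin_seq :: fin_seq is "\<lambda>_. 0" by simp

lift_definition plus_fin_seq :: "fin_seq \<Rightarrow> fin_seq \<Rightarrow> fin_seq" is "\<lambda>x y i. x i + y i"
proof -
  fix f g :: "nat \<Rightarrow> real"
  assume "finite {i. f i \<noteq> 0}" "finite {i. g i \<noteq> 0}"
  then show "finite {i. f i + g i \<noteq> 0}"
    by - (rule finite_subset[of _ "{i. f i \<noteq> 0} \<union> {i. g i \<noteq> 0}"], auto)
qed

lift_definition minus_fin_seq :: "fin_seq \<Rightarrow> fin_seq \<Rightarrow> fin_seq" is "\<lambda>x y i. x i - y i"
proof -
  fix f g :: "nat \<Rightarrow> real"
  assume "finite {i. f i \<noteq> 0}" "finite {i. g i \<noteq> 0}"
  then show "finite {i. f i - g i \<noteq> 0}"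
    by - (rule finite_subset[of _ "{i. f i \<noteq> 0} \<union> {i. g i \<noteq> 0}"], auto)
qed

lift_definition uminus_fin_seq :: "fin_seq \<Rightarrow> fin_seq" is "\<lambda>x i. - x i" by simp

lift_definition scaleR_fin_seq :: "real \<Rightarrow> fin_seq \<Rightarrow> fin_seq" is "\<lambda>r x i. r * x i"
  by (erule finite_subset[rotated]) auto

instance
proof
  fix x y z :: fin_seq and a b :: real
  show "x + y + z = x + (y + z)" by transfer (simp add: add.assoc)
  show "x + y = y + x" by transfer (simp add: add.commute)
  show "0 + x = x" by transfer simp
  show "- x + x = 0" by transfer simp
  show "x - y = x + - y" by transfer simp
  show "a *\<^sub>R (x + y) = a *\<^sub>R x + a *\<^sub>R y" by transfer (simp add: distrib_left)
  show "(a + b) *\<^sub>R x = a *\<^sub>R x + b *\<^sub>R x" by transfer (simp add: distrib_right)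
  show "a *\<^sub>R b *\<^sub>R x = (a * b) *\<^sub>R x" by transfer (simp add: mult.assoc)
  show "1 *\<^sub>R x = x" by transfer simp
qed

end

instantiation fin_seq :: real_inner
begin

definition inner_fin_seq :: "fin_seq \<Rightarrow> fin_seq \<Rightarrow> real" where
  "inner_fin_seq x y = (\<Sum>i | coord x i \<noteq> 0. coord x i * coord y i)"

definition norm_fin_seq :: "fin_seq \<Rightarrow> real" where
  "norm_fin_seq x = sqrt (inner x x)"

definition sgn_fin_seq :: "fin_seq \<Rightarrow> fin_seq" where
  "sgn_fin_seq x = x /\<^sub>R norm x"

definition dist_fin_seq :: "fin_seq \<Rightarrow> fin_seq \<Rightarrow> real" where
  "dist_fin_seq x y = norm (x - y)"

definition uniformity_fin_seq :: "(fin_seq \<times> fin_seq) filter" where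
  "uniformity_fin_seq = (INF e\<in>{0<..}. principal {(x, y). dist x y < e})"

definition open_fin_seq :: "fin_seq set \<Rightarrow> bool" where
  "open_fin_seq U \<longleftrightarrow> (\<forall>x\<in>U. \<forall>\<^sub>F (x', y) in uniformity. x' = x \<longrightarrow> y \<in> U)"

lemma inner_fin_seq_superset:
  assumes "finite A" "{i. coord x i \<noteq> 0} \<subseteq> A"
  shows "inner x y = (\<Sum>i\<in>A. coord x i * coord y i)"
  unfolding inner_fin_seq_def using assms by (intro sum.mono_neutral_left) auto

instance
proof
  fix x y z :: fin_seq and r :: real
  let ?A = "{i. coord x i \<noteq> 0} \<union> {i. coord y i \<noteq> 0}"
  have fin: "finite ?A"
    by (simp add: finite_support)
  have add: "coord (x + y) i = coord x i + coord y i" for i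
    by (simp add: plus_fin_seq.rep_eq)
  show "inner x y = inner y x"
    using inner_fin_seq_superset[OF fin, of x y] inner_fin_seq_superset[OF fin, of y x]
    by (simp add: mult.commute)
  have "inner (x + y) z = (\<Sum>i\<in>?A. coord (x + y) i * coord z i)"
    by (rule inner_fin_seq_superset[OF fin]) (auto simp: add)
  then show "inner (x + y) z = inner x z + inner y z"
    using inner_fin_seq_superset[OF fin, of x z] inner_fin_seq_superset[OF fin, of y z]
    by (simp add: add sum.distrib algebra_simps)
  have "inner (r *\<^sub>R x) z = (\<Sum>i\<in>?A. coord (r *\<^sub>R x) i * coord z i)" for z
    by (rule inner_fin_seq_superset[OF fin]) (auto simp: scaleR_fin_seq.rep_eq)
  then show "inner (r *\<^sub>R x) y = r * inner x y"
    using inner_fin_seq_superset[OF fin, of x y]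
    by (simp add: scaleR_fin_seq.rep_eq sum_distrib_left mult.assoc)
  show "0 \<le> inner x x"
    unfolding inner_fin_seq_def by (intro sum_nonneg) simp
  show "inner x x = 0 \<longleftrightarrow> x = 0"
    unfolding inner_fin_seq_def
    by (subst sum_nonneg_eq_0_iff)
       (auto simp: finite_support fin_seq_eq_iff zero_fin_seq.rep_eq)
qed (simp_all add: norm_fin_seq_def sgn_fin_seq_def dist_fin_seq_def uniformity_fin_seq_def
      open_fin_seq_def)

end

definition Rn :: "nat \<Rightarrow> fin_seq set" where
  "Rn n = {x. \<forall>i. i \<notin> {1..n} \<longrightarrow> coord x i = 0}"

definition orthonormal_basis :: "nat \<Rightarrow> (nat \<Rightarrow> 'a::real_inner) \<Rightarrow> 'a set \<Rightarrow> bool" where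
  "orthonormal_basis n e F \<longleftrightarrow>
     (\<forall>i\<in>{1..n}. \<forall>j\<in>{1..n}. e i \<bullet> e j = (if i = j then 1 else 0)) \<and> span (e ` {1..n}) = F"

text \<open>Origin-centred, non-degenerate ellipsoids of \<open>F\<close>, given by principal axes \<open>u i\<close> and
  semi-axis lengths \<open>a i\<close>.\<close>

definition ellipsoid :: "'a::real_inner set \<Rightarrow> 'a set \<Rightarrow> bool" where
  "ellipsoid F E \<longleftrightarrow>
     (\<exists>u a. orthonormal_basis (dim F) u F \<and> (\<forall>i\<in>{1..dim F}. a i > 0) \<and>
            E = {x \<in> F. (\<Sum>i = 1..dim F. ((x \<bullet> u i) / a i)\<^sup>2) \<le> 1})"

text \<open>The norm with unit ball \<open>K\<close> (on the span of \<open>K\<close>).\<close>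

definition gauge_norm :: "'a::real_vector set \<Rightarrow> 'a \<Rightarrow> real" where
  "gauge_norm K x = Inf {t. t > 0 \<and> x \<in> (*\<^sub>R) t ` K}"

text \<open>Rotations of \<open>F\<close> are all orthogonal maps of \<open>F\<close> onto itself, represented by linear maps of the
  whole type; what such a map does outside \<open>F\<close> is irrelevant.\<close>

definition rotation_of :: "'a::real_inner set \<Rightarrow> ('a \<Rightarrow> 'a) \<Rightarrow> bool" where
  "rotation_of F U \<longleftrightarrow> linear U \<and> U ` F = F \<and> (\<forall>x\<in>F. norm (U x) = norm x)"

definition rotation_invariant_prob :: "'a::real_inner set \<Rightarrow> 'a measure \<Rightarrow> bool" where
  "rotation_invariant_prob F \<mu> \<longleftrightarrow>
     prob_space \<mu> \<and>
     sets \<mu> = sets (restrict_space borel (sphere 0 1 \<inter> F)) \<and>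
     (\<forall>U. rotation_of F U \<longrightarrow> distr \<mu> \<mu> U = \<mu>)"

text \<open>For a finite-dimensional subspace \<open>F \<noteq> {0}\<close> such a measure exists and is unique, so
  the choice made here is immaterial.\<close>

definition sphere_measure :: "'a::real_inner set \<Rightarrow> 'a measure" where
  "sphere_measure F = (SOME \<mu>. rotation_invariant_prob F \<mu>)"

definition M :: "'a::real_inner set \<Rightarrow> 'a set \<Rightarrow> real" where
  "M F K = sqrt (\<integral>x. (gauge_norm K x)\<^sup>2 \<partial>sphere_measure F)"

definition coord_subspace :: "nat \<Rightarrow> (nat \<Rightarrow> fin_seq) \<Rightarrow> nat set \<Rightarrow> fin_seq set" where
  "coord_subspace n e \<sigma> = {x \<in> Rn n. \<forall>j\<in>{1..n}. j \<notin> \<sigma> \<longrightarrow> x \<bullet> e j = 0}"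

definition orth_proj :: "'a::real_inner set \<Rightarrow> 'a \<Rightarrow> 'a" where
  "orth_proj G x = (THE y. y \<in> G \<and> (\<forall>z\<in>G. (x - y) \<bullet> z = 0))"

definition property_P :: "real \<Rightarrow> bool" where
  "property_P c \<longleftrightarrow>
     (\<forall>n\<ge>1. \<forall>E e. \<forall>\<theta>\<in>{0<..<1}.
        ellipsoid (Rn n) E \<longrightarrow> orthonormal_basis n e (Rn n) \<longrightarrow>
        (\<exists>\<sigma>\<subseteq>{1..n}. real (card \<sigma>) \<ge> (1 - \<theta>) * real n \<and>
           (*\<^sub>R) (c * sqrt \<theta> / (sqrt (ln (2 / \<theta>)) * M (Rn n) E))
             ` (cball 0 1 \<inter> coord_subspace n e \<sigma>)
           \<subseteq> orth_proj (coord_subspace n e \<sigma>) ` E))"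

end

theory Submission
  imports Defs
begin

text \<open>
  Write \<open>L\<close> for \<open>log (2/\<zeta>)\<close> and thicken \<open>E\<close> in the directions orthogonal to \<open>F\<close>: let \<open>E'\<close> have the axes
  of \<open>E\<close> together with \<open>n - m\<close> axes of length \<open>b = \<surd>\<epsilon> / M\<^sub>E\<close>. Since \<open>M\<^sub>E\<^sup>2\<close> is the mean of the inverse
  squared semi-axes and \<open>n - m \<le> \<epsilon> n\<close>, we get \<open>M\<^sub>E\<^sub>'\<^sup>2 \<le> 2 M\<^sub>E\<^sup>2\<close>, so property (P) for \<open>E'\<close> yields \<open>\<sigma>\<close> with
  \<open>P\<^sub>\<sigma> E' \<supseteq> 2t D\<^sub>\<sigma>\<close>, where \<open>t = c \<surd>\<zeta> / (2 \<surd>2 \<surd>L M\<^sub>E)\<close>. The choice of \<open>c\<^sub>1\<close> makes \<open>b \<le> t\<close>. Comparing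
  squared support functions on \<open>\<R>\<^sup>\<sigma>\<close> gives \<open>h\<^sub>E\<^sup>2 \<ge> 4t\<^sup>2 - b\<^sup>2 \<ge> t\<^sup>2\<close> on unit vectors, which is \<open>P\<^sub>\<sigma> E \<supseteq> t D\<^sub>\<sigma>\<close>.

  The formula for \<open>M\<^sub>E\<close> needs a rotation invariant measure on the sphere of a subspace of arbitrary
  dimension: it is the radial image of Lebesgue measure on a punctured ball.
\<close>

subsection \<open>Orthonormal bases\<close>

declare One_nat_def [simp del]

text \<open>If some \<open>x\<close> in \<open>T\<close> were outside \<open>span S\<close>, then
  \<open>insert x S\<close> would be an independent subset of \<open>span T\<close> with more than
  \<open>card T\<close> elements. This counting replaces dimension arguments, since the ambient
  space may be infinite-dimensional.\<close>

lemma span_eq_of_card_le: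
  fixes S T :: "'a::real_vector set"
  assumes "independent S" "finite T" "S \<subseteq> span T" "card T \<le> card S"
  shows "span S = span T"
proof
  show "span S \<subseteq> span T"
    using assms(3) by (simp add: span_minimal)
  have "T \<subseteq> span S"
  proof
    fix x assume "x \<in> T"
    show "x \<in> span S"
    proof (rule ccontr)
      assume x: "x \<notin> span S"
      have S: "finite S"
        using independent_span_bound[OF assms(2,1,3)] by simp
      have "independent (insert x S)"
        using assms(1) x by (simp add: independent_insert)
      moreover have "insert x S \<subseteq> span T"
        using assms(3) \<open>x \<in> T\<close> by (simp add: span_base)
      ultimately have "card (insert x S) \<le> card T"
        using independent_span_bound[OF assms(2)] by blast
      moreover have "x \<notin> S"
        using x span_base by blast
      ultimately show False
        using S assms(4) by simp
    qed
  qed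
  then show "span T \<subseteq> span S"
    by (simp add: span_minimal)
qed

context
  fixes n :: nat and u :: "nat \<Rightarrow> 'a::real_inner" and F :: "'a set"
  assumes onb: "orthonormal_basis n u F"
begin

lemma orthonormal_basis_inner:
  "i \<in> {1..n} \<Longrightarrow> j \<in> {1..n} \<Longrightarrow> u i \<bullet> u j = (if i = j then 1 else 0)"
  using onb unfolding orthonormal_basis_def by blast

lemma orthonormal_basis_span: "span (u ` {1..n}) = F"
  using onb unfolding orthonormal_basis_def by blast

lemma orthonormal_basis_subspace: "subspace F"
  using subspace_span[of "u ` {1..n}"] by (simp only: orthonormal_basis_span)

lemma orthonormal_basis_mem: "i \<in> {1..n} \<Longrightarrow> u i \<in> F"
  using span_base[of "u i" "u ` {1..n}"] unfolding orthonormal_basis_span by blast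

lemma orthonormal_basis_sum_mem: "I \<subseteq> {1..n} \<Longrightarrow> (\<Sum>i\<in>I. f i *\<^sub>R u i) \<in> F"
  using orthonormal_basis_mem orthonormal_basis_subspace
  by (intro subspace_sum subspace_scale) auto

lemma orthonormal_basis_inj: "inj_on u {1..n}"
  by (rule inj_onI) (metis orthonormal_basis_inner zero_neq_one)

lemma orthonormal_basis_independent: "independent (u ` {1..n})"
proof (rule pairwise_orthogonal_independent)
  show "pairwise orthogonal (u ` {1..n})"
    using orthonormal_basis_inner by (auto simp: pairwise_def orthogonal_def)
  show "0 \<notin> u ` {1..n}"
    using orthonormal_basis_inner by force
qed

lemma orthonormal_basis_card: "card (u ` {1..n}) = n"
  using card_image[OF orthonormal_basis_inj] by simp

lemma orthonormal_basis_dim: "dim F = n"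
  using dim_span_eq_card_independent[OF orthonormal_basis_independent]
  unfolding orthonormal_basis_span orthonormal_basis_card .

lemma inner_orthonormal_sum:
  assumes "I \<subseteq> {1..n}" "j \<in> {1..n}"
  shows "(\<Sum>i\<in>I. f i *\<^sub>R u i) \<bullet> u j = (if j \<in> I then f j else 0)"
proof -
  have I: "finite I"
    using assms(1) finite_subset by blast
  have "(\<Sum>i\<in>I. f i *\<^sub>R u i) \<bullet> u j = (\<Sum>i\<in>I. f i * (u i \<bullet> u j))"
    by (simp add: inner_sum_left)
  also have "\<dots> = (\<Sum>i\<in>I. if i = j then f j else 0)"
    using assms orthonormal_basis_inner by (intro sum.cong refl) auto
  finally show ?thesis
    using I by (simp add: sum.delta')
qed

text \<open>The residual \<open>?y\<close> lies in \<open>F\<close> and is orthogonal to every basis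
  vector, hence to their span \<open>F\<close>, hence to itself.\<close>

lemma orthonormal_expansion:
  assumes "x \<in> F"
  shows "(\<Sum>i=1..n. (x \<bullet> u i) *\<^sub>R u i) = x"
proof -
  let ?y = "x - (\<Sum>i=1..n. (x \<bullet> u i) *\<^sub>R u i)"
  have "?y \<in> F"
    using assms orthonormal_basis_sum_mem orthonormal_basis_subspace
    by (intro subspace_diff) auto
  moreover have "orthogonal ?y (u i)" if "i \<in> {1..n}" for i
    using inner_orthonormal_sum[OF order_refl that] that by (simp add: orthogonal_def inner_diff_left)
  ultimately have "orthogonal ?y ?y"
    by (intro orthogonal_to_span[of ?y "u ` {1..n}"]) (auto simp only: orthonormal_basis_span)
  then show ?thesis
    by (simp add: orthogonal_def)
qed

lemma orthonormal_inner:
  assumes "x \<in> F"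
  shows "x \<bullet> z = (\<Sum>i=1..n. (x \<bullet> u i) * (z \<bullet> u i))"
proof -
  have "x \<bullet> z = (\<Sum>i=1..n. (x \<bullet> u i) *\<^sub>R u i) \<bullet> z"
    by (simp only: orthonormal_expansion[OF assms])
  then show ?thesis
    by (simp add: inner_sum_left inner_commute[of z])
qed

lemma orthonormal_norm:
  assumes "x \<in> F"
  shows "(norm x)\<^sup>2 = (\<Sum>i=1..n. (x \<bullet> u i)\<^sup>2)"
  unfolding power2_norm_eq_inner
  using orthonormal_inner[OF assms, of x] by (simp add: power2_eq_square)

lemma orthonormal_basis_le:
  assumes "orthonormal_basis k v V" "F \<subseteq> V"
  shows "n \<le> k"
proof -
  have "u ` {1..n} \<subseteq> V"
    using orthonormal_basis_mem assms(2) by blast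
  then have "u ` {1..n} \<subseteq> span (v ` {1..k})"
    using assms(1) by (simp add: orthonormal_basis_def)
  then show ?thesis
    using independent_span_bound[OF _ orthonormal_basis_independent, of "v ` {1..k}"]
      card_image_le[of "{1..k}" v]
    by (simp add: orthonormal_basis_card)
qed

end

text \<open>One Gram-Schmidt step: the new vector is the normalised residual of some
  \<open>w\<close> in \<open>V\<close> outside \<open>F\<close>.\<close>

lemma orthonormal_basis_extend_one:
  fixes u :: "nat \<Rightarrow> 'a::real_inner"
  assumes u: "orthonormal_basis m u F" and V: "subspace V" "F \<subset> V"
  shows "\<exists>v G. orthonormal_basis (Suc m) v G \<and> G \<subseteq> V \<and> (\<forall>i\<in>{1..m}. v i = u i)"
proof -
  obtain w where w: "w \<in> V" "w \<notin> F"
    using V by blast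
  define y where "y = w - (\<Sum>i=1..m. (w \<bullet> u i) *\<^sub>R u i)"
  have s: "(\<Sum>i=1..m. (w \<bullet> u i) *\<^sub>R u i) \<in> F"
    by (rule orthonormal_basis_sum_mem[OF u]) simp
  have y: "y \<in> V" "y \<noteq> 0"
    using w s V by (auto simp: y_def intro: subspace_diff)
  have yu: "y \<bullet> u i = 0" if "i \<in> {1..m}" for i
    using inner_orthonormal_sum[OF u order_refl that] that by (simp add: y_def inner_diff_left)
  define v where "v = u(Suc m := y /\<^sub>R norm y)"
  have "v ` {1..Suc m} \<subseteq> V"
    using y V orthonormal_basis_mem[OF u] by (auto simp: v_def subspace_scale le_Suc_eq)
  then have "span (v ` {1..Suc m}) \<subseteq> V"
    using V by (simp add: span_minimal)
  moreover have "v i \<bullet> v j = (if i = j then 1 else 0)" if "i \<in> {1..Suc m}" "j \<in> {1..Suc m}" for i j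
  proof -
    have "y \<bullet> y = norm y * norm y"
      by (simp add: dot_square_norm power2_eq_square)
    then have yy: "(y /\<^sub>R norm y) \<bullet> (y /\<^sub>R norm y) = 1"
      using y(2) by (simp add: field_simps)
    show ?thesis
      using that yu[of i] yu[of j] yy orthonormal_basis_inner[OF u, of i j]
      by (auto simp: v_def inner_commute le_Suc_eq)
  qed
  ultimately show ?thesis
    by (intro exI[of _ v] exI[of _ "span (v ` {1..Suc m})"]) (auto simp: orthonormal_basis_def v_def)
qed

text \<open>Induction on the codimension \<open>n - m\<close>. At codimension zero, \<open>u\<close>
  already spans \<open>V\<close> by counting; otherwise the dimensions differ and one Gram-Schmidt
  step applies.\<close>

lemma orthonormal_basis_extend:
  fixes u :: "nat \<Rightarrow> 'a::real_inner"
  assumes u: "orthonormal_basis m u F" and e: "orthonormal_basis n e V" and "F \<subseteq> V"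
  shows "\<exists>v. orthonormal_basis n v V \<and> (\<forall>i\<in>{1..m}. v i = u i)"
  using u \<open>F \<subseteq> V\<close>
proof (induction "n - m" arbitrary: m u F)
  case 0
  then have "m = n"
    using orthonormal_basis_le[OF 0(2) e] by simp
  have "span (u ` {1..m}) = span (e ` {1..n})"
  proof (rule span_eq_of_card_le)
    show "u ` {1..m} \<subseteq> span (e ` {1..n})"
      unfolding orthonormal_basis_span[OF e] using orthonormal_basis_mem[OF 0(2)] 0(3) by blast
  qed (use orthonormal_basis_independent[OF 0(2)] orthonormal_basis_card[OF 0(2)]
      orthonormal_basis_card[OF e] \<open>m = n\<close> in auto)
  then show ?case
    using 0(2) e \<open>m = n\<close> by (intro exI[of _ u]) (simp add: orthonormal_basis_def)
next
  case (Suc k)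
  have "F \<noteq> V"
    using orthonormal_basis_dim[OF Suc(3)] orthonormal_basis_dim[OF e] Suc(2) by auto
  then obtain v G where v: "orthonormal_basis (Suc m) v G" "G \<subseteq> V" "\<forall>i\<in>{1..m}. v i = u i"
    using orthonormal_basis_extend_one[OF Suc(3) orthonormal_basis_subspace[OF e]] Suc(4) by blast
  have "k = n - Suc m"
    using Suc(2) by simp
  from Suc(1)[OF this v(1,2)] v(3) show ?case
    by fastforce
qed

section \<open>Gauges of ellipsoids and uniqueness of orthogonal projections\<close>

text \<open>The form \<open>?q\<close> is homogeneous of degree two, so for positive
  \<open>t\<close> the point \<open>x\<close> lies in the \<open>t\<close>-fold dilate exactly when
  \<open>sqrt (?q x)\<close> is at most \<open>t\<close>.\<close>

lemma gauge_norm_ellipsoid: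
  fixes u :: "nat \<Rightarrow> 'a::real_inner"
  assumes "subspace F" "x \<in> F"
  shows "gauge_norm {x \<in> F. (\<Sum>i=1..m. ((x \<bullet> u i) / a i)\<^sup>2) \<le> 1} x
    = sqrt (\<Sum>i=1..m. ((x \<bullet> u i) / a i)\<^sup>2)" (is "gauge_norm ?E x = sqrt (?q x)")
proof -
  have scale: "?q (r *\<^sub>R x) = r\<^sup>2 * ?q x" for r x
    by (simp add: sum_distrib_left power_divide power_mult_distrib)
  have q: "0 \<le> ?q x"
    by (intro sum_nonneg) simp
  have "x \<in> (*\<^sub>R) t ` ?E \<longleftrightarrow> sqrt (?q x) \<le> t" if t: "t > 0" for t
  proof
    assume "x \<in> (*\<^sub>R) t ` ?E"
    then obtain y where y: "?q y \<le> 1" "x = t *\<^sub>R y"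
      by blast
    have "?q x \<le> t\<^sup>2"
      unfolding y(2) scale using y(1) by (simp add: mult_left_le)
    then show "sqrt (?q x) \<le> t"
      using t real_le_lsqrt by (meson less_imp_le)
  next
    assume "sqrt (?q x) \<le> t"
    then have le: "?q x \<le> t\<^sup>2"
      using sqrt_le_D by blast
    have "?q (x /\<^sub>R t) \<le> 1"
      unfolding scale using le t by (simp add: field_simps power2_eq_square)
    then have "x /\<^sub>R t \<in> ?E"
      using assms by (simp add: subspace_scale)
    then show "x \<in> (*\<^sub>R) t ` ?E"
      using t by (intro image_eqI[of _ _ "x /\<^sub>R t"]) auto
  qed
  then have set: "{t. t > 0 \<and> x \<in> (*\<^sub>R) t ` ?E} = {t. t > 0 \<and> sqrt (?q x) \<le> t}"
    by blast
  \<comment> \<open>The condition \<open>t > 0\<close> makes the set an open half-line when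
    \<open>s = 0\<close> and a closed one otherwise; the infimum is \<open>s\<close> in both
    cases.\<close>
  have "Inf {t. t > 0 \<and> s \<le> t} = s" if "s \<ge> 0" for s :: real
  proof (cases "s = 0")
    case True
    then have "{t. t > 0 \<and> s \<le> t} = {0<..}" by auto
    then show ?thesis using True by simp
  next
    case False
    then have "{t. t > 0 \<and> s \<le> t} = {s..}" using that by auto
    then show ?thesis by simp
  qed
  then show ?thesis
    using q by (simp only: gauge_norm_def set) simp
qed

text \<open>Two candidates for the \<open>THE\<close> in \<open>orth_proj\<close> differ by a vector
  of \<open>G\<close> that is orthogonal to \<open>G\<close>, so to itself.\<close>

lemma orth_proj_eqI:
  fixes G :: "'a::real_inner set"
  assumes G: "subspace G" and y: "y \<in> G" "\<And>z. z \<in> G \<Longrightarrow> (x - y) \<bullet> z = 0"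
  shows "orth_proj G x = y"
  unfolding orth_proj_def
proof (rule the_equality)
  fix y' assume y': "y' \<in> G \<and> (\<forall>z\<in>G. (x - y') \<bullet> z = 0)"
  then have d: "y - y' \<in> G"
    using G y by (simp add: subspace_diff)
  then have "(y - y') \<bullet> (y - y') = 0"
    using y(2)[OF d] y' by (simp add: inner_diff_left)
  then show "y' = y"
    by simp
qed (use y in blast)

subsection \<open>Orthogonal invariance of Lebesgue measure\<close>

text \<open>Lebesgue measure is taken over an index set because the dimension is a variable and
  cannot be fixed by a type.\<close>

abbreviation leb :: "nat set \<Rightarrow> (nat \<Rightarrow> real) measure" where
  "leb I \<equiv> PiM I (\<lambda>_. lborel)"

text \<open>The origin is removed so that radial projection to the sphere makes sense on the whole
  set.\<close>

definition punctured_ball :: "nat set \<Rightarrow> (nat \<Rightarrow> real) set" where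
  "punctured_ball I = {x \<in> space (leb I). 0 < (\<Sum>i\<in>I. (x i)\<^sup>2) \<and> (\<Sum>i\<in>I. (x i)\<^sup>2) \<le> 1}"

lemma space_leb: "space (leb I) = (\<Pi>\<^sub>E i\<in>I. UNIV)"
  by (simp add: space_PiM)

lemma leb_coord_measurable [measurable]: "i \<in> I \<Longrightarrow> (\<lambda>x. x i) \<in> borel_measurable (leb I)"
  using measurable_component_singleton[of i I "\<lambda>_. lborel"] by simp

lemma leb_restrict_measurable:
  "(\<And>i. i \<in> I \<Longrightarrow> f i \<in> borel_measurable N) \<Longrightarrow> (\<lambda>x. \<lambda>i\<in>I. f i x) \<in> measurable N (leb I)"
  by (intro measurable_restrict) simp

lemma punctured_ball_sets [measurable]: "punctured_ball I \<in> sets (leb I)"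
  unfolding punctured_ball_def by measurable

interpretation lborel_product: product_sigma_finite "\<lambda>_::nat. lborel :: real measure"
  by standard

lemma sigma_finite_leb: "finite I \<Longrightarrow> sigma_finite_measure (leb I)"
  by (rule lborel_product.sigma_finite)

text \<open>A product measure is determined by its values on boxes, and a translation acts on a box
  one coordinate at a time.\<close>

lemma distr_leb_translate:
  assumes "finite I"
  shows "distr (leb I) (leb I) (\<lambda>x. \<lambda>i\<in>I. x i + a i) = leb I" (is "distr _ _ ?f = _")
proof (rule lborel_product.PiM_eqI[OF assms])
  have f: "?f \<in> measurable (leb I) (leb I)"
    by (rule leb_restrict_measurable) simp
  fix X :: "nat \<Rightarrow> real set" assume X: "\<And>i. i \<in> I \<Longrightarrow> X i \<in> sets lborel"
  have PX: "Pi\<^sub>E I X \<in> sets (leb I)"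
    using X assms by (intro sets_PiM_I_finite) auto
  have vimage: "?f -` Pi\<^sub>E I X \<inter> space (leb I) = (\<Pi>\<^sub>E i\<in>I. (+) (a i) -` X i)"
    by (auto simp: space_leb PiE_iff extensional_def add.commute)
  have meas: "(+) (a i) -` X i \<in> sets lborel" if "i \<in> I" for i
  proof -
    have "(+) (a i) -` X i \<inter> space borel \<in> sets borel"
      using X[OF that] by (intro measurable_sets[of "(+) (a i)" borel borel]) auto
    then show ?thesis by simp
  qed
  have "emeasure (distr (leb I) (leb I) ?f) (Pi\<^sub>E I X) = (\<Prod>i\<in>I. emeasure lborel ((+) (a i) -` X i))"
    unfolding emeasure_distr[OF f PX] vimage
    using meas by (intro lborel_product.emeasure_PiM assms)
  also have "\<dots> = (\<Prod>i\<in>I. emeasure lborel (X i))"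
  proof (intro prod.cong refl)
    fix i assume "i \<in> I"
    then have "emeasure (distr lborel borel ((+) (a i))) (X i) = emeasure lborel ((+) (a i) -` X i)"
      using X by (subst emeasure_distr) auto
    then show "emeasure lborel ((+) (a i) -` X i) = emeasure lborel (X i)"
      by (simp add: lborel_distr_plus)
  qed
  finally show "emeasure (distr (leb I) (leb I) ?f) (Pi\<^sub>E I X) = (\<Prod>i\<in>I. emeasure lborel (X i))" .
qed simp

lemma nn_integral_leb_translate:
  assumes "finite I" "f \<in> borel_measurable (leb I)"
  shows "(\<integral>\<^sup>+x. f (\<lambda>i\<in>I. x i + a i) \<partial>leb I) = (\<integral>\<^sup>+x. f x \<partial>leb I)"
proof -
  have "(\<lambda>x. \<lambda>i\<in>I. x i + a i) \<in> measurable (leb I) (leb I)"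
    by (rule leb_restrict_measurable) simp
  from nn_integral_distr[OF this, of f] show ?thesis
    using assms(2) unfolding distr_leb_translate[OF assms(1)] by simp
qed

text \<open>The set lies between two cubes. Positive finite measure is what allows normalising to a
  probability and cancelling the ball in the Haar argument below.\<close>

lemma emeasure_punctured_ball:
  assumes "finite I" "I \<noteq> {}"
  shows "emeasure (leb I) (punctured_ball I) \<noteq> 0" "emeasure (leb I) (punctured_ball I) \<noteq> \<infinity>"
proof -
  \<comment> \<open>As \<open>c \<le> 1\<close>, coordinates in \<open>{c/2..c}\<close> have squares
    at most \<open>c\<close>, which sum to at most 1; the lower end \<open>c/2\<close> keeps the
    cube away from the origin.\<close>
  define c where "c = 1 / real (card I)"
  have card: "card I \<ge> 1"
    using assms card_gt_0_iff[of I] by linarith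
  have box: "(\<Pi>\<^sub>E i\<in>I. {a..b}) \<in> sets (leb I)" for a b :: real
    using assms by (intro sets_PiM_I_finite) auto
  have "(\<Pi>\<^sub>E i\<in>I. {c/2..c}) \<subseteq> punctured_ball I"
  proof
    fix x assume x: "x \<in> (\<Pi>\<^sub>E i\<in>I. {c/2..c})"
    then have xi: "c/2 \<le> x i" "x i \<le> c" if "i \<in> I" for i
      using that by (auto simp: PiE_iff)
    have c: "0 < c" "c \<le> 1"
      using card by (auto simp: c_def)
    have pos: "0 < x i" if "i \<in> I" for i
      using xi(1)[OF that] c by linarith
    have "0 < (\<Sum>i\<in>I. (x i)\<^sup>2)"
      using assms pos by (intro sum_pos) force+
    moreover have "(\<Sum>i\<in>I. (x i)\<^sup>2) \<le> (\<Sum>i\<in>I. c)"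
    proof (intro sum_mono)
      fix i assume i: "i \<in> I"
      have "x i * x i \<le> 1 * c"
        using xi[OF i] pos[OF i] c by (intro mult_mono) auto
      then show "(x i)\<^sup>2 \<le> c" by (simp add: power2_eq_square)
    qed
    moreover have "(\<Sum>i\<in>I. c) = 1"
      using card by (simp add: c_def)
    ultimately show "x \<in> punctured_ball I"
      using x by (auto simp: punctured_ball_def space_leb PiE_iff)
  qed
  then have "emeasure (leb I) (\<Pi>\<^sub>E i\<in>I. {c/2..c}) \<le> emeasure (leb I) (punctured_ball I)"
    by (intro emeasure_mono) auto
  moreover have "emeasure (leb I) (\<Pi>\<^sub>E i\<in>I. {c/2..c}) \<noteq> 0"
    using assms card by (subst lborel_product.emeasure_PiM) (auto simp: c_def field_simps)
  ultimately show "emeasure (leb I) (punctured_ball I) \<noteq> 0"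
    by auto
  have "punctured_ball I \<subseteq> (\<Pi>\<^sub>E i\<in>I. {-1..1})"
  proof
    fix x assume x: "x \<in> punctured_ball I"
    have "\<bar>x i\<bar> \<le> 1" if "i \<in> I" for i
    proof -
      have "(x i)\<^sup>2 \<le> (\<Sum>i\<in>I. (x i)\<^sup>2)"
        using assms that by (intro member_le_sum) auto
      then show ?thesis
        using x abs_le_square_iff[of "x i" 1] by (auto simp: punctured_ball_def)
    qed
    then show "x \<in> (\<Pi>\<^sub>E i\<in>I. {-1..1})"
      using x by (auto simp: punctured_ball_def space_leb PiE_iff abs_le_iff minus_le_iff)
  qed
  then have "emeasure (leb I) (punctured_ball I) \<le> emeasure (leb I) (\<Pi>\<^sub>E i\<in>I. {-1..1})"
    using box by (intro emeasure_mono) auto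
  also have "\<dots> = ennreal (2 ^ card I)"
    using assms by (subst lborel_product.emeasure_PiM) (auto simp flip: ennreal_power)
  finally show "emeasure (leb I) (punctured_ball I) \<noteq> \<infinity>"
    using ennreal_less_top le_less_trans by (metis infinity_ennreal_def less_irrefl)
qed

text \<open>Uniqueness of Haar measure: the image \<open>\<nu>\<close> of Lebesgue measure under \<open>V\<close> is translation
  invariant, so evaluating \<open>\<integral>\<integral> 1\<^sub>A(x) 1\<^sub>B(y - x) d\<nu>(x) dy\<close> in both orders gives
  \<open>\<nu>(A) |B| = |A| \<nu>(-B)\<close>, and for the ball \<open>B\<close> one has \<open>\<nu>(-B) = |B|\<close>.\<close>

lemma distr_leb_isometry:
  assumes I: "finite I" "I \<noteq> {}"
    and V [measurable]: "V \<in> measurable (leb I) (leb I)"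
    and add: "\<And>x y. x \<in> space (leb I) \<Longrightarrow> y \<in> space (leb I) \<Longrightarrow>
                 V (\<lambda>i\<in>I. x i + y i) = (\<lambda>i\<in>I. V x i + V y i)"
    and norm: "\<And>x. x \<in> space (leb I) \<Longrightarrow> (\<Sum>i\<in>I. (V x i)\<^sup>2) = (\<Sum>i\<in>I. (x i)\<^sup>2)"
    and surj: "\<And>y. y \<in> space (leb I) \<Longrightarrow> \<exists>x\<in>space (leb I). V x = y"
  shows "distr (leb I) (leb I) V = leb I"
proof (rule measure_eqI)
  interpret L: sigma_finite_measure "leb I"
    by (rule sigma_finite_leb[OF I(1)])
  interpret LL: pair_sigma_finite "leb I" "leb I" ..
  fix X assume "X \<in> sets (distr (leb I) (leb I) V)"
  then have X [measurable]: "X \<in> sets (leb I)" by simp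
  let ?B = "punctured_ball I"
  define f where "f = (indicator X :: _ \<Rightarrow> ennreal)"
  define g where "g = (indicator ?B :: _ \<Rightarrow> ennreal)"
  have f [measurable]: "f \<in> borel_measurable (leb I)" and g [measurable]: "g \<in> borel_measurable (leb I)"
    by (simp_all add: f_def g_def)
  have Vc [measurable]: "(\<lambda>x. V (h x) i) \<in> borel_measurable N"
    if "h \<in> measurable N (leb I)" "i \<in> I" for h N i
    using measurable_compose[OF measurable_compose[OF that(1) V] leb_coord_measurable[OF that(2)]] .
  have fst_c [measurable]: "(\<lambda>p. fst p i) \<in> borel_measurable (leb I \<Otimes>\<^sub>M leb I)"
    and snd_c [measurable]: "(\<lambda>p. snd p i) \<in> borel_measurable (leb I \<Otimes>\<^sub>M leb I)" if "i \<in> I" for i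
    using measurable_compose[OF measurable_fst leb_coord_measurable[OF that]]
      measurable_compose[OF measurable_snd leb_coord_measurable[OF that]] by blast+
  have sub: "(\<lambda>p. \<lambda>i\<in>I. snd p i - V (fst p) i) \<in> measurable (leb I \<Otimes>\<^sub>M leb I) (leb I)"
    by (rule leb_restrict_measurable) (simp add: Vc fst_c snd_c)
  have plus: "(\<lambda>p. \<lambda>i\<in>I. snd p i + V (fst p) i) \<in> measurable (leb I \<Otimes>\<^sub>M leb I) (leb I)"
    by (rule leb_restrict_measurable) (simp add: Vc fst_c snd_c)
  \<comment> \<open>The ball is symmetric and \<open>V\<close> preserves the norm; this is where the
    measure of the reflected ball under the image measure equals that of the ball.\<close>
  have g_minus: "g (\<lambda>i\<in>I. - V x i) = g x" if "x \<in> space (leb I)" for x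
    using norm[OF that] that by (auto simp: g_def punctured_ball_def indicator_def space_leb)
  have "(\<integral>\<^sup>+x. f (V x) \<partial>leb I) * (\<integral>\<^sup>+y. g y \<partial>leb I)
      = (\<integral>\<^sup>+x. (\<integral>\<^sup>+y. f (V x) * g (\<lambda>i\<in>I. y i - V x i) \<partial>leb I) \<partial>leb I)"
  proof (subst nn_integral_multc[symmetric])
    show "(\<integral>\<^sup>+x. f (V x) * (\<integral>\<^sup>+y. g y \<partial>leb I) \<partial>leb I) =
      (\<integral>\<^sup>+x. (\<integral>\<^sup>+y. f (V x) * g (\<lambda>i\<in>I. y i - V x i) \<partial>leb I) \<partial>leb I)"
    proof (rule nn_integral_cong)
      fix x assume "x \<in> space (leb I)"
      have "(\<integral>\<^sup>+y. g (\<lambda>i\<in>I. y i - V x i) \<partial>leb I) = (\<integral>\<^sup>+y. g y \<partial>leb I)"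
        using nn_integral_leb_translate[OF I(1) g, of "\<lambda>i. - V x i"] by simp
      moreover have "(\<lambda>y. g (\<lambda>i\<in>I. y i - V x i)) \<in> borel_measurable (leb I)"
        by (rule measurable_compose[OF leb_restrict_measurable g]) simp
      ultimately show "f (V x) * (\<integral>\<^sup>+y. g y \<partial>leb I) = (\<integral>\<^sup>+y. f (V x) * g (\<lambda>i\<in>I. y i - V x i) \<partial>leb I)"
        by (simp add: nn_integral_cmult)
    qed
  qed measurable
  also have "\<dots> = (\<integral>\<^sup>+y. (\<integral>\<^sup>+x. f (V x) * g (\<lambda>i\<in>I. y i - V x i) \<partial>leb I) \<partial>leb I)"
  proof (rule LL.Fubini'[symmetric])
    have "(\<lambda>p. f (V (fst p)) * g (\<lambda>i\<in>I. snd p i - V (fst p) i)) \<in> borel_measurable (leb I \<Otimes>\<^sub>M leb I)"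
      by (intro borel_measurable_times_ennreal measurable_compose[OF sub g]) measurable
    then show "(\<lambda>(x, y). f (V x) * g (\<lambda>i\<in>I. y i - V x i)) \<in> borel_measurable (leb I \<Otimes>\<^sub>M leb I)"
      by (simp add: case_prod_beta')
  qed
  also have "\<dots> = (\<integral>\<^sup>+y. (\<integral>\<^sup>+x. f (\<lambda>i\<in>I. y i + V x i) * g x \<partial>leb I) \<partial>leb I)"
  proof (rule nn_integral_cong)
    fix y assume y: "y \<in> space (leb I)"
    \<comment> \<open>Surjectivity turns a shift by \<open>y\<close> after \<open>V\<close> into a
      shift by \<open>w\<close> before \<open>V\<close>: replacing \<open>x\<close> by
      \<open>x + w\<close> changes \<open>V x\<close> to \<open>y + V x\<close> and
      \<open>y - V x\<close> to \<open>- V x\<close>.\<close>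
    then obtain w where w: "w \<in> space (leb I)" "V w = y"
      using surj by blast
    let ?h = "\<lambda>x. f (V x) * g (\<lambda>i\<in>I. y i - V x i)"
    have h: "?h \<in> borel_measurable (leb I)"
      by (intro borel_measurable_times_ennreal measurable_compose[OF leb_restrict_measurable g]) measurable
    have "(\<integral>\<^sup>+x. ?h x \<partial>leb I) = (\<integral>\<^sup>+x. ?h (\<lambda>i\<in>I. x i + w i) \<partial>leb I)"
      by (rule nn_integral_leb_translate[OF I(1) h, symmetric])
    also have "\<dots> = (\<integral>\<^sup>+x. f (\<lambda>i\<in>I. y i + V x i) * g x \<partial>leb I)"
    proof (rule nn_integral_cong)
      fix x assume x: "x \<in> space (leb I)"
      have Vxw: "V (\<lambda>i\<in>I. x i + w i) = (\<lambda>i\<in>I. y i + V x i)"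
        using add[OF x w(1)] w(2) by (simp add: add.commute)
      have "(\<lambda>i\<in>I. y i - (\<lambda>i\<in>I. y i + V x i) i) = (\<lambda>i\<in>I. - V x i)"
        by (intro restrict_ext) simp
      then show "?h (\<lambda>i\<in>I. x i + w i) = f (\<lambda>i\<in>I. y i + V x i) * g x"
        unfolding Vxw using g_minus[OF x] by simp
    qed
    finally show "(\<integral>\<^sup>+x. ?h x \<partial>leb I) = (\<integral>\<^sup>+x. f (\<lambda>i\<in>I. y i + V x i) * g x \<partial>leb I)" .
  qed
  also have "\<dots> = (\<integral>\<^sup>+x. (\<integral>\<^sup>+y. f (\<lambda>i\<in>I. y i + V x i) * g x \<partial>leb I) \<partial>leb I)"
  proof (rule LL.Fubini')
    have "(\<lambda>p. f (\<lambda>i\<in>I. snd p i + V (fst p) i) * g (fst p)) \<in> borel_measurable (leb I \<Otimes>\<^sub>M leb I)"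
      by (intro borel_measurable_times_ennreal measurable_compose[OF plus f]) measurable
    then show "(\<lambda>(x, y). f (\<lambda>i\<in>I. y i + V x i) * g x) \<in> borel_measurable (leb I \<Otimes>\<^sub>M leb I)"
      by (simp add: case_prod_beta')
  qed
  also have "\<dots> = (\<integral>\<^sup>+x. (\<integral>\<^sup>+y. f y \<partial>leb I) * g x \<partial>leb I)"
  proof (rule nn_integral_cong)
    fix x assume x: "x \<in> space (leb I)"
    have "(\<lambda>y. f (\<lambda>i\<in>I. y i + V x i)) \<in> borel_measurable (leb I)"
      by (rule measurable_compose[OF leb_restrict_measurable f]) simp
    then show "(\<integral>\<^sup>+y. f (\<lambda>i\<in>I. y i + V x i) * g x \<partial>leb I) = (\<integral>\<^sup>+y. f y \<partial>leb I) * g x"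
      by (simp add: nn_integral_multc nn_integral_leb_translate[OF I(1) f])
  qed
  also have "\<dots> = (\<integral>\<^sup>+y. f y \<partial>leb I) * (\<integral>\<^sup>+x. g x \<partial>leb I)"
    by (rule nn_integral_cmult[OF g])
  \<comment> \<open>The measure of the ball is neither 0 nor infinite, so it cancels.\<close>
  finally have "(\<integral>\<^sup>+x. f (V x) \<partial>leb I) = (\<integral>\<^sup>+y. f y \<partial>leb I)"
    using emeasure_punctured_ball[OF I] by (simp add: g_def mult.commute[of _ "emeasure _ _"] ennreal_mult_cancel_left)
  moreover have "(\<integral>\<^sup>+x. f (V x) \<partial>leb I) = (\<integral>\<^sup>+x. f x \<partial>distr (leb I) (leb I) V)"
    by (simp add: nn_integral_distr)
  ultimately show "emeasure (distr (leb I) (leb I) V) X = emeasure (leb I) X"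
    by (simp add: f_def)
qed simp

subsection \<open>Invariant measure on the sphere\<close>

text \<open>Existence is what gives the \<open>SOME\<close> in \<open>sphere_measure\<close> its
  properties. A rotation \<open>U\<close> of \<open>F\<close> becomes in coordinates a map
  \<open>V\<close> that preserves Lebesgue measure and the punctured ball and is intertwined with
  \<open>U\<close> by radial projection, so the image measure is invariant.\<close>

lemma rotation_invariant_prob_exists:
  fixes u :: "nat \<Rightarrow> 'a::real_inner"
  assumes u: "orthonormal_basis m u F" and m: "m \<ge> 1"
  shows "\<exists>\<mu>. rotation_invariant_prob F \<mu>"
proof -
  let ?I = "{1..m}" and ?S = "sphere 0 1 \<inter> F"
  let ?R = "restrict_space borel ?S" and ?B = "punctured_ball {1..m}"
  define T where "T x = (\<Sum>i=1..m. x i *\<^sub>R u i)" for x :: "nat \<Rightarrow> real"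
  \<comment> \<open>The default \<open>u 1\<close> makes \<open>N\<close> land on the sphere
    everywhere; the punctured ball, which carries \<open>P\<close>, avoids that case.\<close>
  define N where "N x = (if (\<Sum>i=1..m. (x i)\<^sup>2) = 0 then u 1
    else (1 / sqrt (\<Sum>i=1..m. (x i)\<^sup>2)) *\<^sub>R T x)" for x :: "nat \<Rightarrow> real"
  define P where "P = uniform_measure (leb ?I) ?B"
  define \<mu> where "\<mu> = distr P ?R N"
  have I: "finite ?I" "?I \<noteq> {}"
    using m by auto
  have subspF: "subspace F"
    by (rule orthonormal_basis_subspace[OF u])
  have T_mem: "T x \<in> F" for x
    unfolding T_def by (rule orthonormal_basis_sum_mem[OF u]) simp
  have T_inner: "T x \<bullet> u i = x i" if "i \<in> ?I" for x i
    unfolding T_def using inner_orthonormal_sum[OF u order_refl that] that by simp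
  have T_norm: "(norm (T x))\<^sup>2 = (\<Sum>i=1..m. (x i)\<^sup>2)" for x
    unfolding orthonormal_norm[OF u T_mem] by (intro sum.cong) (simp_all add: T_inner)
  have T_inner_eq: "T (\<lambda>i\<in>?I. z \<bullet> u i) = z" if "z \<in> F" for z
    using orthonormal_expansion[OF u that] by (simp add: T_def)
  have T_cong: "T x = T y" if "\<And>i. i \<in> ?I \<Longrightarrow> x i = y i" for x y
    unfolding T_def using that by (intro sum.cong) auto
  have N_mem: "N x \<in> ?S" for x
  proof (cases "(\<Sum>i=1..m. (x i)\<^sup>2) = 0")
    case True
    have "norm (u 1) = 1"
      using orthonormal_basis_inner[OF u, of 1 1] m by (simp add: norm_eq_1)
    then show ?thesis
      using True orthonormal_basis_mem[OF u, of 1] m by (simp add: N_def)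
  next
    case False
    have "sqrt (\<Sum>i=1..m. (x i)\<^sup>2) = norm (T x)"
      by (simp flip: T_norm)
    then show ?thesis
      using False T_mem[of x] subspF by (auto simp: N_def T_norm[symmetric] subspace_scale)
  qed
  have "continuous_on UNIV T"
    unfolding T_def by (intro continuous_intros) simp
  then have Tb: "T \<in> borel_measurable borel"
    by (rule borel_measurable_continuous_onI)
  have N_meas: "N \<in> measurable (leb ?I) ?R"
  proof (rule measurable_restrict_space2)
    show "N \<in> space (leb ?I) \<rightarrow> ?S"
      using N_mem by blast
    let ?s = "\<lambda>x. \<Sum>i=1..m. (x i)\<^sup>2"
    have s: "?s \<in> borel_measurable (leb ?I)"
      by (intro borel_measurable_sum borel_measurable_power leb_coord_measurable)
    \<comment> \<open>Since \<open>'a\<close> need not be second countable, measurability is not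
      built from sums in \<open>'a\<close>. Instead \<open>N\<close> factors through the continuous
      map \<open>T\<close> on \<open>nat \<Rightarrow> real\<close>, where measurability of
      \<open>?k\<close> can be checked coordinatewise.\<close>
    let ?k = "\<lambda>x i. if i \<in> ?I then x i / sqrt (?s x) else 0"
    have "?k \<in> borel_measurable (leb ?I)"
    proof (rule measurable_coordinatewise_then_product)
      fix i
      show "(\<lambda>x. ?k x i) \<in> borel_measurable (leb ?I)"
        using s by (cases "i \<in> ?I") (auto intro!: borel_measurable_divide leb_coord_measurable
            measurable_compose[OF s borel_measurable_sqrt])
    qed
    then have "(\<lambda>x. T (?k x)) \<in> borel_measurable (leb ?I)"
      by (rule measurable_compose[OF _ Tb])
    then have "(\<lambda>x. if ?s x = 0 then u 1 else T (?k x)) \<in> borel_measurable (leb ?I)"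
      using s by (intro measurable_If) simp_all
    moreover have "N x = (if ?s x = 0 then u 1 else T (?k x))" for x
      unfolding N_def T_def by (simp add: scaleR_sum_right)
    ultimately show "N \<in> borel_measurable (leb ?I)"
      by presburger
  qed
  then have N_measP: "N \<in> measurable P ?R"
    by (simp add: P_def)
  have "prob_space P"
    unfolding P_def by (rule prob_space_uniform_measure[OF emeasure_punctured_ball[OF I]])
  then have prob: "prob_space \<mu>"
    unfolding \<mu>_def by (rule prob_space.prob_space_distr[OF _ N_measP])
  have sets: "sets \<mu> = sets ?R" and space: "space \<mu> = ?S"
    by (simp_all add: \<mu>_def space_restrict_space)
  have "distr \<mu> \<mu> U = \<mu>" if U: "rotation_of F U" for U
  proof -
    have linU: "linear U" and UF: "U ` F = F" and normU: "\<And>x. x \<in> F \<Longrightarrow> norm (U x) = norm x"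
      using U by (auto simp: rotation_of_def)
    define V where "V x = (\<lambda>i\<in>?I. U (T x) \<bullet> u i)" for x
    have TV: "T (V x) = U (T x)" for x
      unfolding V_def using T_mem[of x] UF by (intro T_inner_eq) blast
    have "(\<Sum>i=1..m. (V x i)\<^sup>2) = (\<Sum>i=1..m. (x i)\<^sup>2)" for x
      using T_norm[of "V x"] T_norm[of x] TV[of x] normU[OF T_mem[of x]] by simp
    note V_norm = this
    have V_meas: "V \<in> measurable (leb ?I) (leb ?I)"
      unfolding V_def T_def linear_sum[OF linU] linear_scale[OF linU] inner_sum_left inner_scaleR_left
      by (intro leb_restrict_measurable borel_measurable_sum borel_measurable_times
          leb_coord_measurable borel_measurable_const)
    have V_distr: "distr (leb ?I) (leb ?I) V = leb ?I"
    proof (rule distr_leb_isometry[OF I V_meas])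
      fix x y
      have "T (\<lambda>i\<in>?I. x i + y i) = T x + T y"
        by (simp add: T_def scaleR_add_left sum.distrib)
      then show "V (\<lambda>i\<in>?I. x i + y i) = (\<lambda>i\<in>?I. V x i + V y i)"
        unfolding V_def by (intro restrict_ext) (simp add: linear_add[OF linU] inner_add_left)
    next
      fix y assume y: "y \<in> space (leb ?I)"
      have "T y \<in> U ` F"
        using UF T_mem by blast
      then obtain z where z: "z \<in> F" "T y = U z"
        by blast
      have "V (\<lambda>i\<in>?I. z \<bullet> u i) = (\<lambda>i\<in>?I. y i)"
        unfolding V_def T_inner_eq[OF z(1)] z(2)[symmetric] by (intro restrict_ext) (simp add: T_inner)
      then show "\<exists>x\<in>space (leb ?I). V x = y"
        using y by (intro bexI[of _ "\<lambda>i\<in>?I. z \<bullet> u i"]) (auto simp: space_leb)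
    qed (rule V_norm)
    \<comment> \<open>On the ball \<open>x\<close> and \<open>V x\<close> have the same nonzero
      norm, so \<open>U\<close> passes through the scaling factor in \<open>N\<close>.\<close>
    have UN: "U (N x) = N (V x)" if "x \<in> ?B" for x
      using that unfolding punctured_ball_def N_def V_norm
      by (simp add: TV linear_scale[OF linU])
    have VB: "V x \<in> ?B \<longleftrightarrow> x \<in> ?B" if "x \<in> space (leb ?I)" for x
      using that measurable_space[OF V_meas that] unfolding punctured_ball_def by (simp add: V_norm)
    \<comment> \<open>A linear map of the whole type need not be continuous, but on \<open>F\<close>
      the map \<open>U\<close> is an isometry.\<close>
    have "continuous_on ?S U"
    proof (rule continuous_onI)
      fix x and e :: real assume x: "x \<in> ?S" "e > 0"
      have "dist (U x') (U x) = dist x' x" if "x' \<in> ?S" for x'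
        using normU[of "x' - x"] x that subspF by (simp add: dist_norm linear_diff[OF linU, symmetric] subspace_diff)
      then show "\<exists>d>0. \<forall>x'\<in>?S. dist x' x < d \<longrightarrow> dist (U x') (U x) \<le> e"
        using x(2) by (intro exI[of _ e]) auto
    qed
    then have "U \<in> measurable ?R ?R"
      using normU UF by (intro measurable_restrict_space2 borel_measurable_continuous_on_restrict)
        (auto simp: space_restrict_space)
    then have U_meas: "U \<in> measurable \<mu> \<mu>"
      using measurable_cong_sets[OF sets sets] by blast
    show ?thesis
    proof (rule measure_eqI)
      fix X assume "X \<in> sets (distr \<mu> \<mu> U)"
      then have X: "X \<in> sets \<mu>" by simp
      have \<mu>_eq: "emeasure \<mu> Y = emeasure (leb ?I) (?B \<inter> (N -` Y \<inter> space (leb ?I))) / emeasure (leb ?I) ?B"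
        if "Y \<in> sets \<mu>" for Y
      proof -
        have "N -` Y \<inter> space (leb ?I) \<in> sets (leb ?I)"
          using that sets by (intro measurable_sets[OF N_meas]) simp
        then show ?thesis
          using that sets unfolding \<mu>_def
          by (subst emeasure_distr[OF N_measP]) (simp_all add: P_def)
      qed
      let ?Y = "U -` X \<inter> space \<mu>" and ?A = "?B \<inter> (N -` X \<inter> space (leb ?I))"
      have Y: "?Y \<in> sets \<mu>"
        by (rule measurable_sets[OF U_meas X])
      have A: "?A \<in> sets (leb ?I)"
        by (intro sets.Int[OF punctured_ball_sets] measurable_sets[OF N_meas]) (use X sets in simp)
      have "emeasure (leb ?I) ?A = emeasure (distr (leb ?I) (leb ?I) V) ?A"
        by (simp only: V_distr)
      also have "\<dots> = emeasure (leb ?I) (V -` ?A \<inter> space (leb ?I))"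
        by (rule emeasure_distr[OF V_meas A])
      also have "V -` ?A \<inter> space (leb ?I) = ?B \<inter> (N -` ?Y \<inter> space (leb ?I))"
        using VB UN N_mem measurable_space[OF V_meas] by (auto simp: space)
      finally show "emeasure (distr \<mu> \<mu> U) X = emeasure \<mu> X"
        unfolding emeasure_distr[OF U_meas X] \<mu>_eq[OF X] \<mu>_eq[OF Y] by simp
    qed simp
  qed
  then show ?thesis
    using prob sets unfolding rotation_invariant_prob_def by blast
qed

text \<open>This is the reflection in the hyperplane orthogonal to \<open>w\<close>; its usual
  coefficient is \<open>2 / (w \<bullet> w) = 1\<close>. It is an involution, hence onto, and it
  interchanges \<open>u i\<close> and \<open>u j\<close>.\<close>

lemma rotation_of_swap:
  fixes u :: "nat \<Rightarrow> 'a::real_inner"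
  assumes u: "orthonormal_basis m u F" and ij: "i \<in> {1..m}" "j \<in> {1..m}" "i \<noteq> j"
  defines "w \<equiv> u i - u j"
  shows "rotation_of F (\<lambda>x. x - (x \<bullet> w) *\<^sub>R w)" (is "rotation_of F ?U")
    and "(x - (x \<bullet> w) *\<^sub>R w) \<bullet> u i = x \<bullet> u j"
proof -
  have subspF: "subspace F"
    by (rule orthonormal_basis_subspace[OF u])
  have w: "w \<in> F" "w \<bullet> w = 2" "w \<bullet> u i = 1"
    using ij orthonormal_basis_mem[OF u] subspF orthonormal_basis_inner[OF u]
    by (auto simp: w_def subspace_diff inner_diff_left inner_diff_right)
  have "linear ?U"
    by (rule linearI) (simp_all add: inner_add_left algebra_simps)
  moreover have U_mem: "?U x \<in> F" if "x \<in> F" for x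
    using that w subspF by (simp add: subspace_diff subspace_scale)
  moreover have "?U (?U x) = x" for x
    using w by (simp add: inner_diff_left algebra_simps flip: scaleR_add_left)
  then have "?U ` F = F"
    using U_mem by (intro subset_antisym subsetI image_subsetI image_eqI[of _ ?U "?U x" for x]) auto
  moreover have "norm (?U x) = norm x" for x
  proof -
    have "?U x \<bullet> ?U x = x \<bullet> x - 2 * (x \<bullet> w)\<^sup>2 + (x \<bullet> w)\<^sup>2 * (w \<bullet> w)"
      unfolding inner_diff_left inner_diff_right inner_scaleR_left inner_scaleR_right
        inner_commute[of w x] power2_eq_square by (simp only: algebra_simps)
    then show ?thesis
      using w(2) by (simp add: norm_eq)
  qed
  ultimately show "rotation_of F ?U"
    by (simp add: rotation_of_def)
  show "(x - (x \<bullet> w) *\<^sub>R w) \<bullet> u i = x \<bullet> u j"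
    using w by (simp add: inner_diff_left) (simp add: w_def inner_diff_right)
qed

text \<open>Swapping two axes is a rotation, so all \<open>m\<close> coordinates have the same
  second moment, and on the unit sphere the squares add up to 1.\<close>

lemma sphere_integral_coord_square:
  fixes u :: "nat \<Rightarrow> 'a::real_inner"
  assumes u: "orthonormal_basis m u F" and \<mu>: "rotation_invariant_prob F \<mu>" and i: "i \<in> {1..m}"
  shows "integrable \<mu> (\<lambda>x. (x \<bullet> u i)\<^sup>2)" and "(\<integral>x. (x \<bullet> u i)\<^sup>2 \<partial>\<mu>) = 1 / real m"
proof -
  have sets: "sets \<mu> = sets (restrict_space borel (sphere 0 1 \<inter> F))"
    and rot: "\<And>U. rotation_of F U \<Longrightarrow> distr \<mu> \<mu> U = \<mu>"
    using \<mu> by (auto simp: rotation_invariant_prob_def)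
  interpret prob_space \<mu>
    using \<mu> by (simp add: rotation_invariant_prob_def)
  have space: "space \<mu> = sphere 0 1 \<inter> F"
    using sets_eq_imp_space_eq[OF sets] by (simp add: space_restrict_space)
  have cont: "f \<in> borel_measurable \<mu>" if "continuous_on (sphere 0 1 \<inter> F) f" for f :: "'a \<Rightarrow> 'b::topological_space"
    using borel_measurable_continuous_on_restrict[OF that] measurable_cong_sets[OF sets refl] by blast
  have meas: "(\<lambda>x. (x \<bullet> u k)\<^sup>2) \<in> borel_measurable \<mu>" for k
    by (intro cont continuous_intros)
  have int: "integrable \<mu> (\<lambda>x. (x \<bullet> u k)\<^sup>2)" if k: "k \<in> {1..m}" for k
  proof (rule integrable_const_bound[of _ 1])
    have "(x \<bullet> u k)\<^sup>2 \<le> 1" if "x \<in> space \<mu>" for x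
    proof -
      have "norm (u k) = 1"
        using orthonormal_basis_inner[OF u k k] by (simp add: norm_eq_1)
      then have "\<bar>x \<bullet> u k\<bar> \<le> 1"
        using Cauchy_Schwarz_ineq2[of x "u k"] that by (simp add: space)
      then show ?thesis
        using abs_le_square_iff[of "x \<bullet> u k" 1] by simp
    qed
    then show "AE x in \<mu>. norm ((x \<bullet> u k)\<^sup>2) \<le> 1"
      by simp
  qed (rule meas)
  have eq: "(\<integral>x. (x \<bullet> u k)\<^sup>2 \<partial>\<mu>) = (\<integral>x. (x \<bullet> u i)\<^sup>2 \<partial>\<mu>)" if k: "k \<in> {1..m}" for k
  proof (cases "k = i")
    case False
    define U where "U x = x - (x \<bullet> (u i - u k)) *\<^sub>R (u i - u k)" for x
    have U: "rotation_of F U" "\<And>x. U x \<bullet> u i = x \<bullet> u k"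
      using rotation_of_swap[OF u i k] False unfolding U_def by auto
    have "U \<in> measurable \<mu> \<mu>"
    proof -
      have "U \<in> measurable \<mu> (restrict_space borel (sphere 0 1 \<inter> F))"
      proof (rule measurable_restrict_space2)
        show "U \<in> space \<mu> \<rightarrow> sphere 0 1 \<inter> F"
          using U(1) unfolding rotation_of_def space by auto
        show "U \<in> borel_measurable \<mu>"
          unfolding U_def by (intro cont continuous_intros)
      qed
      then show ?thesis
        using measurable_cong_sets[OF refl sets] by blast
    qed
    then have "(\<integral>x. (x \<bullet> u i)\<^sup>2 \<partial>distr \<mu> \<mu> U) = (\<integral>x. (U x \<bullet> u i)\<^sup>2 \<partial>\<mu>)"
      by (rule integral_distr) (rule meas)
    then show ?thesis
      by (simp add: rot[OF U(1)] U(2))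
  qed simp
  have "real m * (\<integral>x. (x \<bullet> u i)\<^sup>2 \<partial>\<mu>) = (\<Sum>k=1..m. (\<integral>x. (x \<bullet> u k)\<^sup>2 \<partial>\<mu>))"
    using eq by simp
  also have "\<dots> = (\<integral>x. (\<Sum>k=1..m. (x \<bullet> u k)\<^sup>2) \<partial>\<mu>)"
    by (rule Bochner_Integration.integral_sum[symmetric]) (rule int)
  also have "\<dots> = (\<integral>x. 1 \<partial>\<mu>)"
  proof (rule Bochner_Integration.integral_cong[OF refl])
    fix x assume "x \<in> space \<mu>"
    then show "(\<Sum>k=1..m. (x \<bullet> u k)\<^sup>2) = 1"
      using orthonormal_norm[OF u, of x] by (simp add: space)
  qed
  also have "\<dots> = 1"
    by (simp add: prob_space)
  finally show "(\<integral>x. (x \<bullet> u i)\<^sup>2 \<partial>\<mu>) = 1 / real m"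
    using i by (simp add: field_simps)
  show "integrable \<mu> (\<lambda>x. (x \<bullet> u i)\<^sup>2)"
    by (rule int[OF i])
qed

text \<open>The squared gauge is a weighted sum of squared coordinates, and invariance alone fixes
  their means, whichever measure the choice in \<open>sphere_measure\<close> returns.\<close>

lemma M_ellipsoid:
  fixes u :: "nat \<Rightarrow> 'a::real_inner"
  assumes u: "orthonormal_basis m u F" and m: "m \<ge> 1"
  shows "M F {x \<in> F. (\<Sum>i=1..m. ((x \<bullet> u i) / a i)\<^sup>2) \<le> 1} = sqrt ((\<Sum>i=1..m. 1 / (a i)\<^sup>2) / real m)"
proof -
  define \<mu> where "\<mu> = sphere_measure F"
  have \<mu>: "rotation_invariant_prob F \<mu>"
    unfolding \<mu>_def sphere_measure_def
    by (rule someI_ex[OF rotation_invariant_prob_exists[OF u m]])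
  then have "space \<mu> = sphere 0 1 \<inter> F"
    using sets_eq_imp_space_eq[of \<mu> "restrict_space borel (sphere 0 1 \<inter> F)"]
    by (simp add: rotation_invariant_prob_def space_restrict_space)
  then have "(\<integral>x. (gauge_norm {x \<in> F. (\<Sum>i=1..m. ((x \<bullet> u i) / a i)\<^sup>2) \<le> 1} x)\<^sup>2 \<partial>\<mu>)
      = (\<integral>x. (\<Sum>i=1..m. (x \<bullet> u i)\<^sup>2 / (a i)\<^sup>2) \<partial>\<mu>)"
    using gauge_norm_ellipsoid[OF orthonormal_basis_subspace[OF u], of _ u a m]
    by (intro Bochner_Integration.integral_cong refl)
       (simp add: power_divide sum_nonneg)
  also have "\<dots> = (\<Sum>i=1..m. (\<integral>x. (x \<bullet> u i)\<^sup>2 / (a i)\<^sup>2 \<partial>\<mu>))"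
    using sphere_integral_coord_square(1)[OF u \<mu>]
    by (intro Bochner_Integration.integral_sum) (simp add: divide_inverse)
  also have "\<dots> = (\<Sum>i=1..m. 1 / (a i)\<^sup>2 / real m)"
    using sphere_integral_coord_square(2)[OF u \<mu>]
    by (intro sum.cong refl) simp
  finally show ?thesis
    by (simp add: M_def \<mu>_def sum_divide_distrib)
qed

subsection \<open>Projections of ellipsoids\<close>

lemma coord_subspace_eq_span:
  assumes e: "orthonormal_basis n e (Rn n)" and \<sigma>: "\<sigma> \<subseteq> {1..n}"
  shows "coord_subspace n e \<sigma> = span (e ` \<sigma>)"
proof
  show "coord_subspace n e \<sigma> \<subseteq> span (e ` \<sigma>)"
  proof
    fix x assume x: "x \<in> coord_subspace n e \<sigma>"
    then have "(\<Sum>i=1..n. (x \<bullet> e i) *\<^sub>R e i) = (\<Sum>i\<in>\<sigma>. (x \<bullet> e i) *\<^sub>R e i)"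
      using \<sigma> by (intro sum.mono_neutral_right) (auto simp: coord_subspace_def)
    then have "x = (\<Sum>i\<in>\<sigma>. (x \<bullet> e i) *\<^sub>R e i)"
      using orthonormal_expansion[OF e, of x] x by (simp add: coord_subspace_def)
    moreover have "(\<Sum>i\<in>\<sigma>. (x \<bullet> e i) *\<^sub>R e i) \<in> span (e ` \<sigma>)"
      by (intro span_sum span_scale span_base) simp
    ultimately show "x \<in> span (e ` \<sigma>)"
      by simp
  qed
  have "subspace (coord_subspace n e \<sigma>)"
    using orthonormal_basis_subspace[OF e]
    by (auto simp: coord_subspace_def subspace_def inner_add_left)
  moreover have "e j \<in> coord_subspace n e \<sigma>" if "j \<in> \<sigma>" for j
    using that \<sigma> orthonormal_basis_mem[OF e, of j] orthonormal_basis_inner[OF e, of j]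
    by (auto simp: coord_subspace_def)
  ultimately show "span (e ` \<sigma>) \<subseteq> coord_subspace n e \<sigma>"
    by (simp add: span_minimal image_subset_iff)
qed

lemma subspace_coord_subspace:
  "orthonormal_basis n e (Rn n) \<Longrightarrow> \<sigma> \<subseteq> {1..n} \<Longrightarrow> subspace (coord_subspace n e \<sigma>)"
  by (simp add: coord_subspace_eq_span)

text \<open>The second claim lets pairings with vectors of the coordinate subspace be computed
  before projecting.\<close>

lemma orth_proj_coord_subspace:
  assumes e: "orthonormal_basis n e (Rn n)" and \<sigma>: "\<sigma> \<subseteq> {1..n}" and x: "x \<in> Rn n"
  shows "orth_proj (coord_subspace n e \<sigma>) x = (\<Sum>j\<in>\<sigma>. (x \<bullet> e j) *\<^sub>R e j)" (is "_ = ?p")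
    and "z \<in> coord_subspace n e \<sigma> \<Longrightarrow> (\<Sum>j\<in>\<sigma>. (x \<bullet> e j) *\<^sub>R e j) \<bullet> z = x \<bullet> z"
proof -
  have p: "?p \<in> coord_subspace n e \<sigma>"
    unfolding coord_subspace_eq_span[OF e \<sigma>] by (intro span_sum span_scale span_base) simp
  have orth: "(x - ?p) \<bullet> z = 0" if "z \<in> coord_subspace n e \<sigma>" for z
  proof -
    have "x - ?p \<in> Rn n"
      using x p orthonormal_basis_subspace[OF e] by (simp add: coord_subspace_def subspace_diff)
    from orthonormal_inner[OF e this]
    have "(x - ?p) \<bullet> z = (\<Sum>i=1..n. ((x - ?p) \<bullet> e i) * (z \<bullet> e i))" .
    also have "\<dots> = 0"
    proof (intro sum.neutral ballI)
      fix i assume i: "i \<in> {1..n}"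
      \<comment> \<open>For \<open>i\<close> in \<open>\<sigma>\<close> the first factor vanishes,
        otherwise the second.\<close>
      show "((x - ?p) \<bullet> e i) * (z \<bullet> e i) = 0"
        using inner_orthonormal_sum[OF e \<sigma> i, of "\<lambda>j. x \<bullet> e j"] that i
        by (cases "i \<in> \<sigma>") (auto simp: coord_subspace_def inner_diff_left)
    qed
    finally show ?thesis .
  qed
  show "orth_proj (coord_subspace n e \<sigma>) x = ?p"
    by (rule orth_proj_eqI[OF subspace_coord_subspace[OF e \<sigma>] p orth])
  show "z \<in> coord_subspace n e \<sigma> \<Longrightarrow> ?p \<bullet> z = x \<bullet> z"
    using orth[of z] by (simp add: inner_diff_left)
qed

text \<open>The right-hand side is the squared support function of the ellipsoid at
  \<open>z\<close>. The point of length \<open>r\<close> in direction \<open>z\<close> lifts to some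
  \<open>x\<close> in the ellipsoid with \<open>x \<bullet> z = r * norm z\<close>, and
  Cauchy-Schwarz bounds this pairing.\<close>

lemma ellipsoid_support_lower_bound:
  assumes e: "orthonormal_basis n e (Rn n)" and \<sigma>: "\<sigma> \<subseteq> {1..n}"
    and v: "orthonormal_basis n v (Rn n)" and \<alpha>: "\<And>i. i \<in> {1..n} \<Longrightarrow> \<alpha> i > 0"
    and sub: "(*\<^sub>R) r ` (cball 0 1 \<inter> coord_subspace n e \<sigma>) \<subseteq>
      orth_proj (coord_subspace n e \<sigma>) ` {x \<in> Rn n. (\<Sum>i=1..n. ((x \<bullet> v i) / \<alpha> i)\<^sup>2) \<le> 1}"
    and z: "z \<in> coord_subspace n e \<sigma>"
  shows "r\<^sup>2 * (norm z)\<^sup>2 \<le> (\<Sum>i=1..n. (\<alpha> i * (z \<bullet> v i))\<^sup>2)"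
proof (cases "z = 0")
  case False
  have "z /\<^sub>R norm z \<in> cball 0 1 \<inter> coord_subspace n e \<sigma>"
    using z False subspace_coord_subspace[OF e \<sigma>] by (simp add: subspace_scale)
  then have "r *\<^sub>R (z /\<^sub>R norm z) \<in>
      orth_proj (coord_subspace n e \<sigma>) ` {x \<in> Rn n. (\<Sum>i=1..n. ((x \<bullet> v i) / \<alpha> i)\<^sup>2) \<le> 1}"
    using sub by blast
  then obtain x where x: "x \<in> Rn n" "(\<Sum>i=1..n. ((x \<bullet> v i) / \<alpha> i)\<^sup>2) \<le> 1"
    and xz: "orth_proj (coord_subspace n e \<sigma>) x = r *\<^sub>R (z /\<^sub>R norm z)"
    by auto
  have "x \<bullet> z = (r *\<^sub>R (z /\<^sub>R norm z)) \<bullet> z"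
    using orth_proj_coord_subspace[OF e \<sigma> x(1)] z xz by simp
  also have "\<dots> = r * norm z"
    using False by (simp add: dot_square_norm power2_eq_square)
  finally have "r * norm z = (\<Sum>i=1..n. (x \<bullet> v i) * (z \<bullet> v i))"
    using orthonormal_inner[OF v x(1), of z] by simp
  \<comment> \<open>The weights \<open>\<alpha> i\<close> are distributed so that one Cauchy-Schwarz
    factor is the form defining the ellipsoid.\<close>
  also have "\<dots> = (\<Sum>i=1..n. ((x \<bullet> v i) / \<alpha> i) * (\<alpha> i * (z \<bullet> v i)))"
    using \<alpha> by (intro sum.cong refl) force
  finally have "(r * norm z)\<^sup>2 \<le> (\<Sum>i=1..n. ((x \<bullet> v i) / \<alpha> i)\<^sup>2) * (\<Sum>i=1..n. (\<alpha> i * (z \<bullet> v i))\<^sup>2)"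
    using Cauchy_Schwarz_ineq_sum by metis
  also have "\<dots> \<le> 1 * (\<Sum>i=1..n. (\<alpha> i * (z \<bullet> v i))\<^sup>2)"
    using x(2) by (intro mult_right_mono sum_nonneg) auto
  finally show ?thesis
    by (simp add: power_mult_distrib)
qed (simp add: sum_nonneg)

text \<open>With \<open>S z = \<Sum> (a i)\<^sup>2 \<langle>z, u i\<rangle> u i\<close>, the hypothesis says that the compression of \<open>S\<close> to \<open>\<R>\<^sup>\<sigma>\<close>
  is positive definite, hence onto; \<open>S z\<close> is the point of \<open>E\<close> above a given \<open>y\<close>.\<close>

lemma orth_proj_ellipsoid_superset:
  assumes e: "orthonormal_basis n e (Rn n)" and \<sigma>: "\<sigma> \<subseteq> {1..n}"
    and u: "orthonormal_basis m u F" and F: "F \<subseteq> Rn n" and a: "\<And>i. i \<in> {1..m} \<Longrightarrow> a i > 0"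
    and t: "t > 0"
    and low: "\<And>z. z \<in> coord_subspace n e \<sigma> \<Longrightarrow> t\<^sup>2 * (norm z)\<^sup>2 \<le> (\<Sum>i=1..m. (a i * (z \<bullet> u i))\<^sup>2)"
  shows "(*\<^sub>R) t ` (cball 0 1 \<inter> coord_subspace n e \<sigma>) \<subseteq>
    orth_proj (coord_subspace n e \<sigma>) ` {x \<in> F. (\<Sum>i=1..m. ((x \<bullet> u i) / a i)\<^sup>2) \<le> 1}"
proof -
  let ?G = "coord_subspace n e \<sigma>"
  let ?Q = "\<lambda>z. \<Sum>i=1..m. (a i * (z \<bullet> u i))\<^sup>2"
  have G: "subspace ?G" "?G = span (e ` \<sigma>)"
    using subspace_coord_subspace[OF e \<sigma>] coord_subspace_eq_span[OF e \<sigma>] .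
  define S where "S z = (\<Sum>i=1..m. ((a i)\<^sup>2 * (z \<bullet> u i)) *\<^sub>R u i)" for z
  define T where "T z = (\<Sum>j\<in>\<sigma>. (S z \<bullet> e j) *\<^sub>R e j)" for z
  have S_mem: "S z \<in> F" for z
    unfolding S_def by (rule orthonormal_basis_sum_mem[OF u]) simp
  have S_inner: "S z \<bullet> u i = (a i)\<^sup>2 * (z \<bullet> u i)" if "i \<in> {1..m}" for z i
    unfolding S_def using inner_orthonormal_sum[OF u order_refl that] that by simp
  have "linear S"
    unfolding S_def
    by (rule linearI)
       (simp_all add: inner_add_left distrib_left scaleR_add_left sum.distrib scaleR_sum_right mult.left_commute)
  note linear_add[OF this] linear_scale[OF this]
  then have linT: "linear T"
    unfolding T_def
    by (intro linearI) (simp_all add: inner_add_left scaleR_add_left sum.distrib scaleR_sum_right)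
  have proj: "orth_proj ?G (S z) = T z" for z
    unfolding T_def using orth_proj_coord_subspace(1)[OF e \<sigma>] S_mem F by blast
  have TQ: "T z \<bullet> z = ?Q z" if "z \<in> ?G" for z
  proof -
    have "T z \<bullet> z = S z \<bullet> z"
      unfolding T_def using orth_proj_coord_subspace(2)[OF e \<sigma> _ that] S_mem F by blast
    also have "\<dots> = (\<Sum>i=1..m. (S z \<bullet> u i) * (z \<bullet> u i))"
      by (rule orthonormal_inner[OF u S_mem])
    also have "\<dots> = ?Q z"
      by (intro sum.cong refl) (simp add: S_inner power2_eq_square)
    finally show ?thesis .
  qed
  \<comment> \<open>A kernel vector \<open>d\<close> in the subspace has
    \<open>t^2 |d|^2 \<le> T d \<bullet> d = 0\<close> by \<open>low\<close> and \<open>TQ\<close>.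
    Surjectivity then follows by counting the images of the basis.\<close>
  have inj: "inj_on T (span (e ` \<sigma>))"
  proof (rule inj_onI)
    fix x y assume xy: "x \<in> span (e ` \<sigma>)" "y \<in> span (e ` \<sigma>)" "T x = T y"
    then have d: "x - y \<in> ?G"
      using G by (simp add: subspace_diff)
    have "T (x - y) = 0"
      using xy(3) by (simp add: linear_diff[OF linT])
    then have "t\<^sup>2 * (norm (x - y))\<^sup>2 \<le> 0"
      using TQ[OF d] low[OF d] by simp
    then show "x = y"
      using t by (simp add: mult_le_0_iff)
  qed
  have indep: "independent (e ` \<sigma>)"
    using orthonormal_basis_independent[OF e] \<sigma> by (rule independent_mono[OF _ image_mono])
  have T_mem: "T z \<in> span (e ` \<sigma>)" for z
    unfolding T_def by (intro span_sum span_scale span_base) simp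
  have "span (T ` e ` \<sigma>) = span (e ` \<sigma>)"
  proof (rule span_eq_of_card_le)
    show "independent (T ` e ` \<sigma>)"
      by (rule linear_independent_injective_image[OF linT indep inj])
    show "finite (e ` \<sigma>)"
      using \<sigma> finite_subset by blast
    show "T ` e ` \<sigma> \<subseteq> span (e ` \<sigma>)"
      using T_mem by blast
    have "inj_on T (e ` \<sigma>)"
      by (rule inj_on_subset[OF inj]) (rule span_superset)
    then show "card (e ` \<sigma>) \<le> card (T ` e ` \<sigma>)"
      by (simp add: card_image)
  qed
  then have surj: "T ` ?G = ?G"
    by (simp add: G linear_span_image[OF linT])
  show ?thesis
  proof
    fix y assume "y \<in> (*\<^sub>R) t ` (cball 0 1 \<inter> ?G)"
    then obtain w where w: "norm w \<le> 1" "w \<in> ?G" "y = t *\<^sub>R w"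
      by auto
    have "y \<in> T ` ?G"
      unfolding surj w(3) using G w(2) by (simp add: subspace_scale)
    then obtain z where z: "z \<in> ?G" "y = T z"
      by blast
    \<comment> \<open>\<open>?Q z\<close> is at most \<open>t * norm z\<close> as a pairing with
      \<open>y\<close>, while \<open>low\<close> bounds it below by the square of that number. Hence
      \<open>?Q z\<close> dominates its own square and is at most 1; it is also the defining form of
      \<open>E\<close> at \<open>S z\<close>.\<close>
    have "?Q z = y \<bullet> z"
      using TQ[OF z(1)] z(2) by simp
    also have "\<dots> \<le> norm y * norm z"
      by (rule norm_cauchy_schwarz)
    also have "\<dots> \<le> t * norm z"
      using w t by (intro mult_right_mono) (auto simp: mult_left_le)
    finally have "(?Q z)\<^sup>2 \<le> (t * norm z)\<^sup>2"
      by (intro power_mono sum_nonneg) auto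
    also have "\<dots> \<le> ?Q z"
      using low[OF z(1)] by (simp add: power_mult_distrib)
    finally have "(?Q z)\<^sup>2 \<le> ?Q z" .
    moreover have "q \<le> 1" if "q\<^sup>2 \<le> q" for q :: real
    proof (rule ccontr)
      assume "\<not> q \<le> 1"
      then have "1 * q < q * q"
        by (intro mult_strict_right_mono) auto
      with that show False
        by (simp add: power2_eq_square)
    qed
    ultimately have "?Q z \<le> 1"
      by blast
    moreover have "(\<Sum>i=1..m. ((S z \<bullet> u i) / a i)\<^sup>2) = ?Q z"
      using a by (intro sum.cong refl) (force simp: S_inner power2_eq_square)
    ultimately show "y \<in> orth_proj ?G ` {x \<in> F. (\<Sum>i=1..m. ((x \<bullet> u i) / a i)\<^sup>2) \<le> 1}"
      using S_mem[of z] proj[of z] z(2) by (intro image_eqI[of _ _ "S z"]) auto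
  qed
qed

section \<open>Thickening the ellipsoid and fixing the constants\<close>

theorem theorem2p3:
  fixes c c1 \<epsilon> \<zeta> :: real
    and n m :: nat
    and e :: "nat \<Rightarrow> fin_seq"
    and F E :: "fin_seq set"
  assumes "c > 0" and "property_P c"
    and "c1 = max (8 / c\<^sup>2) (1 / ln 2)"
    and "n \<ge> 1" and "orthonormal_basis n e (Rn n)"
    and "\<epsilon> \<in> {0<..<1}"
    and "subspace F" and "F \<subseteq> Rn n" and "dim F = m" and "real m \<ge> (1 - \<epsilon>) * real n"
    and "ellipsoid F E"
    and "\<zeta> \<in> {c1 * \<epsilon> * ln (2 / \<epsilon>)..<1}"
  shows "\<exists>\<sigma>\<subseteq>{1..n}. real (card \<sigma>) \<ge> (1 - \<zeta>) * real n \<and>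
           (*\<^sub>R) (c * sqrt \<zeta> / (2 * sqrt 2 * sqrt (ln (2 / \<zeta>)) * M F E))
             ` (cball 0 1 \<inter> coord_subspace n e \<sigma>)
           \<subseteq> orth_proj (coord_subspace n e \<sigma>) ` E"
proof -
  note c = \<open>c > 0\<close> and n = \<open>n \<ge> 1\<close> and e = \<open>orthonormal_basis n e (Rn n)\<close>
  have \<epsilon>: "0 < \<epsilon>" "\<epsilon> < 1"
    using assms by auto
  obtain u a where u: "orthonormal_basis m u F" and a: "\<And>i. i \<in> {1..m} \<Longrightarrow> a i > 0"
    and E: "E = {x \<in> F. (\<Sum>i=1..m. ((x \<bullet> u i) / a i)\<^sup>2) \<le> 1}"
    using \<open>ellipsoid F E\<close> unfolding ellipsoid_def \<open>dim F = m\<close> by blast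
  \<comment> \<open>A positive dimension of \<open>F\<close> is required for the formula for
    \<open>M F E\<close>.\<close>
  have "0 < (1 - \<epsilon>) * real n"
    using \<epsilon> n by simp
  then have m: "m \<ge> 1"
    using \<open>real m \<ge> (1 - \<epsilon>) * real n\<close> by linarith
  obtain v where v: "orthonormal_basis n v (Rn n)" and vu: "\<And>i. i \<in> {1..m} \<Longrightarrow> v i = u i"
    using orthonormal_basis_extend[OF u e \<open>F \<subseteq> Rn n\<close>] by blast
  have mn: "m \<le> n"
    by (rule orthonormal_basis_le[OF u e \<open>F \<subseteq> Rn n\<close>])
  have split: "sum f {1..n} = sum f {1..m} + sum f {m<..n}" for f :: "nat \<Rightarrow> real"
    using mn by (subst sum.union_disjoint[symmetric]) (auto intro!: sum.cong)
  define K where "K = M F E"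
  have K: "K = sqrt ((\<Sum>i=1..m. 1 / (a i)\<^sup>2) / real m)"
    unfolding K_def E by (rule M_ellipsoid[OF u m])
  have "(\<Sum>i=1..m. 1 / (a i)\<^sup>2) > 0"
    using a m by (intro sum_pos) force+
  then have Kpos: "K > 0" and K2: "(\<Sum>i=1..m. 1 / (a i)\<^sup>2) = real m * K\<^sup>2"
    using m by (auto simp: K)
  \<comment> \<open>With this length each added axis contributes \<open>K^2 / \<epsilon>\<close> to
    the sum of inverse squares, so at most \<open>\<epsilon> * n\<close> of them add no more than
    \<open>n * K^2\<close>.\<close>
  define b where "b = sqrt \<epsilon> / K"
  have b: "b > 0" and b2: "b\<^sup>2 = \<epsilon> / K\<^sup>2"
    using \<epsilon> Kpos by (auto simp: b_def power_divide)
  define \<alpha> where "\<alpha> i = (if i \<le> m then a i else b)" for i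
  have \<alpha>: "\<alpha> i > 0" if "i \<in> {1..n}" for i
    using that a b by (auto simp: \<alpha>_def)
  define E' where "E' = {x \<in> Rn n. (\<Sum>i=1..n. ((x \<bullet> v i) / \<alpha> i)\<^sup>2) \<le> 1}"
  have E': "ellipsoid (Rn n) E'"
    using v \<alpha> unfolding ellipsoid_def orthonormal_basis_dim[OF e] E'_def by blast
  define K' where "K' = M (Rn n) E'"
  have K': "K' = sqrt ((\<Sum>i=1..n. 1 / (\<alpha> i)\<^sup>2) / real n)"
    unfolding K'_def E'_def by (rule M_ellipsoid[OF v n])
  have \<alpha>sum: "(\<Sum>i=1..n. 1 / (\<alpha> i)\<^sup>2) = real m * K\<^sup>2 + (real n - real m) * (K\<^sup>2 / \<epsilon>)"
    using mn by (simp add: split \<alpha>_def b2 of_nat_diff flip: K2)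
  have "(\<Sum>i=1..n. 1 / (\<alpha> i)\<^sup>2) > 0"
    using \<alpha> n by (intro sum_pos) force+
  then have K'pos: "K' > 0"
    using n by (simp add: K')
  have "(\<Sum>i=1..n. 1 / (\<alpha> i)\<^sup>2) \<le> real n * K\<^sup>2 + (\<epsilon> * real n) * (K\<^sup>2 / \<epsilon>)"
    unfolding \<alpha>sum using mn \<epsilon> \<open>real m \<ge> (1 - \<epsilon>) * real n\<close>
    by (intro add_mono mult_right_mono) (auto simp: algebra_simps)
  also have "\<dots> = real n * (2 * K\<^sup>2)"
    using \<epsilon> by simp
  finally have "(\<Sum>i=1..n. 1 / (\<alpha> i)\<^sup>2) / real n \<le> 2 * K\<^sup>2"
    using n by (simp add: pos_divide_le_eq mult.commute)
  then have "K' \<le> sqrt (2 * K\<^sup>2)"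
    unfolding K' by (rule real_sqrt_le_mono)
  then have K'_le: "K' \<le> sqrt 2 * K"
    using Kpos by (simp add: real_sqrt_mult)
  have ln2\<epsilon>: "ln 2 \<le> ln (2 / \<epsilon>)" and ln2: "0 < ln (2::real)"
    using \<epsilon> by (simp_all add: field_simps)
  have c1_le: "k * (\<epsilon> * ln (2 / \<epsilon>)) \<le> \<zeta>" if "k \<le> c1" for k
  proof -
    have "k * (\<epsilon> * ln (2 / \<epsilon>)) \<le> c1 * (\<epsilon> * ln (2 / \<epsilon>))"
      using that \<epsilon> ln2\<epsilon> ln2 by (intro mult_right_mono) auto
    then show ?thesis
      using assms(12) by (simp add: mult.assoc)
  qed
  \<comment> \<open>The part \<open>1 / ln 2\<close> of \<open>c1\<close> gives
    \<open>\<epsilon> \<le> \<zeta>\<close>; this makes \<open>\<zeta>\<close> positive and yields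
    the comparison of logarithms below.\<close>
  have "\<epsilon> * 1 \<le> \<epsilon> * (ln (2 / \<epsilon>) / ln 2)"
    using \<epsilon> ln2\<epsilon> ln2 by (intro mult_left_mono) (auto simp: field_simps)
  also have "\<dots> = (1 / ln 2) * (\<epsilon> * ln (2 / \<epsilon>))"
    by simp
  also have "\<dots> \<le> \<zeta>"
    by (rule c1_le) (simp add: assms(3))
  finally have \<epsilon>\<zeta>: "\<epsilon> \<le> \<zeta>"
    by simp
  then have \<zeta>: "0 < \<zeta>" "\<zeta> < 1"
    using \<epsilon> assms(12) by auto
  define L where "L = ln (2 / \<zeta>)"
  have L: "L > 0"
    using \<zeta> by (simp add: L_def)
  \<comment> \<open>The part \<open>8 / c^2\<close> of \<open>c1\<close> is tuned to give
    \<open>8 * \<epsilon> * L \<le> c^2 * \<zeta>\<close>, which amounts to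
    \<open>b \<le> t\<close>.\<close>
  have "L \<le> ln (2 / \<epsilon>)"
    unfolding L_def using \<epsilon> \<zeta> \<epsilon>\<zeta> by (simp add: frac_le)
  then have "(8 / c\<^sup>2) * (\<epsilon> * L) \<le> (8 / c\<^sup>2) * (\<epsilon> * ln (2 / \<epsilon>))"
    using \<epsilon> by (intro mult_left_mono) auto
  also have "\<dots> \<le> \<zeta>"
    by (rule c1_le) (simp add: assms(3))
  finally have \<epsilon>L: "8 * \<epsilon> * L \<le> c\<^sup>2 * \<zeta>"
    using c by (simp add: field_simps)
  have \<zeta>_mem: "\<zeta> \<in> {0<..<1}"
    using \<zeta> by simp
  obtain \<sigma> where \<sigma>: "\<sigma> \<subseteq> {1..n}" "real (card \<sigma>) \<ge> (1 - \<zeta>) * real n"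
    and sub: "(*\<^sub>R) (c * sqrt \<zeta> / (sqrt L * K')) ` (cball 0 1 \<inter> coord_subspace n e \<sigma>)
      \<subseteq> orth_proj (coord_subspace n e \<sigma>) ` E'"
    using \<open>property_P c\<close>[unfolded property_P_def, rule_format, OF n \<zeta>_mem E' e]
    unfolding L_def K'_def by blast
  define r where "r = c * sqrt \<zeta> / (sqrt L * K')"
  define t where "t = c * sqrt \<zeta> / (2 * sqrt 2 * sqrt L * K)"
  have t: "t > 0"
    using c \<zeta> L Kpos by (simp add: t_def)
  \<comment> \<open>The denominator \<open>2 * sqrt 2\<close> of \<open>t\<close> splits up here:
    \<open>sqrt 2\<close> pays for passing from \<open>K\<close> to \<open>K'\<close>, and the
    factor 2 is the slack used to remove the added axes.\<close>
  have "2 * t = c * sqrt \<zeta> / (sqrt L * (sqrt 2 * K))"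
    by (simp add: t_def)
  also have "\<dots> \<le> r"
    unfolding r_def using c \<zeta> L Kpos K'pos K'_le by (intro divide_left_mono mult_left_mono) auto
  finally have "(2 * t)\<^sup>2 \<le> r\<^sup>2"
    using t by (intro power_mono) auto
  moreover have "b\<^sup>2 \<le> t\<^sup>2"
  proof -
    have "t\<^sup>2 = (c\<^sup>2 * \<zeta> / (8 * L)) / K\<^sup>2"
      using \<zeta> L by (simp add: t_def power_divide power_mult_distrib)
    moreover have "\<epsilon> \<le> c\<^sup>2 * \<zeta> / (8 * L)"
      using \<epsilon>L L by (simp add: field_simps)
    ultimately show ?thesis
      unfolding b2 by (simp only: divide_right_mono zero_le_power2)
  qed
  \<comment> \<open>\<open>t^2 + b^2 \<le> 2 t^2 \<le> 4 t^2 \<le> r^2\<close>.\<close>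
  ultimately have rbt: "t\<^sup>2 + b\<^sup>2 \<le> r\<^sup>2"
    by (simp add: power_mult_distrib) (use zero_le_power2[of t] in linarith)
  have "t\<^sup>2 * (norm z)\<^sup>2 \<le> (\<Sum>i=1..m. (a i * (z \<bullet> u i))\<^sup>2)" if z: "z \<in> coord_subspace n e \<sigma>" for z
  proof -
    have "(t\<^sup>2 + b\<^sup>2) * (norm z)\<^sup>2 \<le> r\<^sup>2 * (norm z)\<^sup>2"
      using rbt by (intro mult_right_mono) auto
    also have "\<dots> \<le> (\<Sum>i=1..n. (\<alpha> i * (z \<bullet> v i))\<^sup>2)"
      using ellipsoid_support_lower_bound[OF e \<sigma>(1) v \<alpha> sub[unfolded E'_def] z] by (simp add: r_def)
    also have "\<dots> = (\<Sum>i=1..m. (a i * (z \<bullet> u i))\<^sup>2) + (\<Sum>i\<in>{m<..n}. (b * (z \<bullet> v i))\<^sup>2)"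
      unfolding split by (intro arg_cong2[of _ _ _ _ "(+)"] sum.cong refl) (auto simp: \<alpha>_def vu)
    \<comment> \<open>The added axes contribute at most \<open>b^2 |z|^2\<close>, which cancels the
      \<open>b^2\<close> reserved in \<open>rbt\<close>.\<close>
    also have "(\<Sum>i\<in>{m<..n}. (b * (z \<bullet> v i))\<^sup>2) \<le> b\<^sup>2 * (norm z)\<^sup>2"
    proof -
      have "(norm z)\<^sup>2 = (\<Sum>i=1..n. (z \<bullet> v i)\<^sup>2)"
        using orthonormal_norm[OF v] z by (simp add: coord_subspace_def)
      then have "(\<Sum>i\<in>{m<..n}. (z \<bullet> v i)\<^sup>2) \<le> (norm z)\<^sup>2"
        by (simp add: split sum_nonneg)
      then show ?thesis
        by (simp add: power_mult_distrib mult_left_mono flip: sum_distrib_left)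
    qed
    finally show ?thesis
      by (simp add: algebra_simps)
  qed
  then have "(*\<^sub>R) t ` (cball 0 1 \<inter> coord_subspace n e \<sigma>) \<subseteq> orth_proj (coord_subspace n e \<sigma>) ` E"
    unfolding E by (intro orth_proj_ellipsoid_superset[OF e \<sigma>(1) u \<open>F \<subseteq> Rn n\<close> a t]) auto
  then show ?thesis
    using \<sigma> unfolding t_def L_def K_def by blast
qed

end
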